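(* For every integer $m$ with $5\le m\le 11$, $\nu_m=4$. For every integer $m\geq 12$, there is a unique integer $n\ge 5$ for which $2^{n-1}-\mu_{n-1}+1\le m\le 2^{n}-\mu_n$, and for this $n$ one has $\nu_m=n$.
   Context: All matrices are binary, with entries regarded as elements of $\mathbb{Z}_2$. For an $m\times n$ matrix $X$, a row permutation is a $\sigma\in S_m$, and $X_\sigma$ is the result of applying $\sigma$ to the rows of $X$ (row $i$ is moved to position $\sigma(i)$). A column permaut is a pair $\varphi=(\pi,\{\psi_i\}_{i=1}^n)$ with $\pi\in S_n$ and each $\psi_i:\mathbb{Z}_2\to\mathbb{Z}_2$ a bijection (the identity or the swap $0\leftrightarrow 1$); $X^\varphi$ is the $m\times n$ matrix whose column $j$ is obtained from column $\pi^{-1}(j)$ of $X$ by applying $\psi_{\pi^{-1}(j)}$ to each entry. A symmetry of $X$ is a pair $(\sigma,\varphi)$ with $X_\sigma=X^\varphi$. $X$ is asymmetric if its only symmetry is the trivial one $(id,id)$. For $n\ge 4$, $\mu_n$ denotes the smallest number of rows for which there is an asymmetric binary $\mu_n\times n$ matrix. For $m\ge 5$, $\nu_m$ denotes the smallest number of columns for which there is an asymmetric binary $m\times\nu_m$ matrix. (Equivalently, $\mu_n=\rho(Q_n)$, the minimum size of a label class over all labelings of the vertices of the $n$-dimensional hypercube $Q_n$ with two labels that are preserved by no nontrivial automorphism of $Q_n$.) *)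

theory Defs
  imports
    "Jordan_Normal_Form.Matrix"
    "HOL-Combinatorics.Permutations"
    "HOL-Library.Z2"
begin

text \<open>
  Binary matrices are matrices over the two-element field \<^typ>\<open>bit\<close>; rows and columns are
  numbered from \<open>0\<close>, so \<open>S\<^sub>m\<close> is the set of functions that permute \<open>{..<m}\<close>.
\<close>

definition row_permute :: "(nat \<Rightarrow> nat) \<Rightarrow> bit mat \<Rightarrow> bit mat" where
  "row_permute \<sigma> X = mat (dim_row X) (dim_col X) (\<lambda>(i, j). X $$ (inv_into UNIV \<sigma> i, j))"

text \<open>
  In a pair \<open>(\<pi>, \<psi>)\<close> only the values \<open>\<psi> j\<close> with \<open>j < n\<close> are meaningful; the others are
  ignored by every definition below.
\<close>

type_synonym permaut = "(nat \<Rightarrow> nat) \<times> (nat \<Rightarrow> bit \<Rightarrow> bit)"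

definition column_permaut :: "nat \<Rightarrow> permaut \<Rightarrow> bool" where
  "column_permaut n = (\<lambda>(\<pi>, \<psi>). \<pi> permutes {..<n} \<and> (\<forall>j<n. bij (\<psi> j)))"

definition trivial_permaut :: "nat \<Rightarrow> permaut \<Rightarrow> bool" where
  "trivial_permaut n = (\<lambda>(\<pi>, \<psi>). \<pi> = id \<and> (\<forall>j<n. \<psi> j = id))"

definition apply_permaut :: "bit mat \<Rightarrow> permaut \<Rightarrow> bit mat" where
  "apply_permaut X = (\<lambda>(\<pi>, \<psi>).
     mat (dim_row X) (dim_col X) (\<lambda>(i, j). \<psi> (inv_into UNIV \<pi> j) (X $$ (i, inv_into UNIV \<pi> j))))"

definition matrix_symmetry :: "bit mat \<Rightarrow> (nat \<Rightarrow> nat) \<Rightarrow> permaut \<Rightarrow> bool" where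
  "matrix_symmetry X \<sigma> \<phi> \<longleftrightarrow>
     \<sigma> permutes {..<dim_row X} \<and> column_permaut (dim_col X) \<phi> \<and>
     row_permute \<sigma> X = apply_permaut X \<phi>"

definition asymmetric :: "bit mat \<Rightarrow> bool" where
  "asymmetric X \<longleftrightarrow>
     (\<forall>\<sigma> \<phi>. matrix_symmetry X \<sigma> \<phi> \<longrightarrow> \<sigma> = id \<and> trivial_permaut (dim_col X) \<phi>)"

definition \<mu> :: "nat \<Rightarrow> nat" where
  "\<mu> n = (LEAST m. \<exists>X \<in> carrier_mat m n. asymmetric X)"

definition \<nu> :: "nat \<Rightarrow> nat" where
  "\<nu> m = (LEAST n. \<exists>X \<in> carrier_mat m n. asymmetric X)"

end

theory Submission
  imports Defs
begin

text \<open>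
  The rows of an asymmetric matrix are distinct, so an asymmetric \<open>m \<times> n\<close> matrix is a set of \<open>m\<close>
  vertices of the cube \<open>Q\<^sub>n\<close> that is \<^emph>\<open>rigid\<close>: preserved by no automorphism of the cube except
  the identity. For \<open>m \<ge> 1\<close> it is also a family of \<open>n\<close> distinct \<^emph>\<open>splits\<close> of the \<open>m\<close> rows into
  two sides, given by the columns, that is preserved by no permutation of the rows except the
  identity (\<open>has_asymmetric_iff_split_rigid\<close>).

  The necessary conditions come from these two views. A set of vertices and its complement have
  the same symmetries, so \<open>m\<close> rows are possible if and only if \<open>2 ^ n - m\<close> rows are
  (\<open>has_asymmetric_complement\<close>). There are \<open>2 ^ (m - 1)\<close> splits, so \<open>n \<le> 2 ^ (m - 1)\<close>
  (\<open>has_asymmetric_columns_le\<close>). On two, three or four rows every family of splits has a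
  nontrivial symmetry, so \<open>m \<ge> 5\<close> as soon as \<open>n \<ge> 2\<close> (\<open>has_asymmetric_rows_ge\<close>).

  The main step, \<open>has_asymmetric_half\<close>, constructs an asymmetric matrix whenever
  \<open>5 \<le> m \<le> 2 ^ (n - 1)\<close> and \<open>4 \<le> n \<le> 2 ^ (m - 2)\<close>. The idea is a small rigid frame that every
  symmetry has to preserve, to which arbitrary material of a different kind is added. For
  \<open>m \<le> n + 1\<close> the frame consists of columns: the edges of a path on the rows and a mark at one
  end. The added columns are splits that are not edges. For \<open>m \<ge> n\<close> and \<open>n \<ge> 6\<close> the frame
  consists of \<open>n\<close> vertices of even cardinality, and the added rows are vertices of odd
  cardinality. The few remaining cases, in dimensions 4 and 5, are sets of vertices that are
  told apart by their distances to the others.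

  It follows that for \<open>n \<ge> 4\<close> the possible numbers of rows are exactly \<open>\<mu> n, \<dots>, 2 ^ n - \<mu> n\<close>
  (\<open>has_asymmetric_iff_between\<close>): a number of rows \<open>m > \<mu> n\<close> satisfies
  \<open>n \<le> 2 ^ (\<mu> n - 1) \<le> 2 ^ (m - 2)\<close>, and complements give the upper half. Since
  \<open>\<mu> n \<le> 2 ^ (n - 1)\<close>, the upper ends \<open>2 ^ n - \<mu> n\<close> increase strictly with \<open>n\<close>, beginning with
  \<open>2 ^ 4 - 5 = 11\<close>. Hence every \<open>m \<ge> 12\<close> lies between exactly one pair of consecutive upper
  ends, and the smallest number of columns that admits \<open>m\<close> rows is the first \<open>n\<close> whose upper end
  is at least \<open>m\<close>.
\<close>

section \<open>Asymmetric matrices as rigid sets of vertices of the cube\<close>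

text \<open>
  A symmetry of a set that is listed without repetition permutes the indices of the list.
\<close>

lemma index_permutation:
  fixes r :: "nat \<Rightarrow> 'a"
  assumes inj: "inj_on r {..<m}" and img: "\<phi> ` r ` {..<m} = r ` {..<m}"
  obtains \<sigma> where "\<sigma> permutes {..<m}" "\<And>i. i < m \<Longrightarrow> r i = \<phi> (r (\<sigma> i))"
proof -
  have ex: "\<exists>k. k < m \<and> r i = \<phi> (r k)" if "i < m" for i
  proof -
    have "r i \<in> \<phi> ` r ` {..<m}" unfolding img using that by simp
    then show ?thesis by auto
  qed
  define \<sigma> where "\<sigma> i = (if i < m then SOME k. k < m \<and> r i = \<phi> (r k) else i)" for i
  have \<sigma>: "\<sigma> i < m \<and> r i = \<phi> (r (\<sigma> i))" if "i < m" for i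
    using someI_ex[OF ex[OF that]] that by (simp add: \<sigma>_def)
  have "inj_on \<sigma> {..<m}"
    by (rule inj_onI) (metis \<sigma> inj inj_on_eq_iff lessThan_iff)
  moreover have "\<sigma> ` {..<m} \<subseteq> {..<m}" using \<sigma> by auto
  ultimately have "bij_betw \<sigma> {..<m} {..<m}"
    using endo_inj_surj[of "{..<m}" \<sigma>] by (simp add: bij_betw_def)
  then have "\<sigma> permutes {..<m}" by (rule bij_imp_permutes) (simp add: \<sigma>_def)
  then show thesis using \<sigma> that by blast
qed

lemma permutes_imageE:
  assumes "\<pi> permutes A" "x \<in> A"
  obtains j where "j \<in> A" "x = \<pi> j"
proof -
  have "x \<in> \<pi> ` A" using assms(2) by (simp only: permutes_image[OF assms(1)])
  then show thesis using that by (auto elim: imageE)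
qed

text \<open>
  The vertices of the cube \<open>Q\<^sub>n\<close> are the subsets of \<open>{..<n}\<close>. An automorphism of the cube
  permutes the coordinates by \<open>\<pi>\<close> and then flips those in \<open>c\<close>.
\<close>

definition cube_map :: "(nat \<Rightarrow> nat) \<Rightarrow> nat set \<Rightarrow> nat set \<Rightarrow> nat set" where
  "cube_map \<pi> c v = sym_diff (\<pi> ` v) c"

definition rigid :: "nat \<Rightarrow> nat set set \<Rightarrow> bool" where
  "rigid n S \<longleftrightarrow> (\<forall>\<pi> c. \<pi> permutes {..<n} \<and> c \<subseteq> {..<n} \<and> cube_map \<pi> c ` S = S \<longrightarrow> \<pi> = id \<and> c = {})"

definition has_asymmetric :: "nat \<Rightarrow> nat \<Rightarrow> bool" where
  "has_asymmetric m n \<longleftrightarrow> (\<exists>X \<in> carrier_mat m n. asymmetric X)"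

definition row_set :: "bit mat \<Rightarrow> nat \<Rightarrow> nat set" where
  "row_set X i = {j. j < dim_col X \<and> X $$ (i, j) = 1}"

lemma cube_map_mem:
  assumes "\<pi> permutes A"
  shows "\<pi> j \<in> cube_map \<pi> c v \<longleftrightarrow> (j \<in> v) \<noteq> (\<pi> j \<in> c)"
  using permutes_inj[OF assms] by (auto simp: cube_map_def inj_image_mem_iff)

lemma cube_map_subset:
  assumes "\<pi> permutes A" "c \<subseteq> A" "v \<subseteq> A"
  shows "cube_map \<pi> c v \<subseteq> A"
proof -
  have "\<pi> ` v \<subseteq> A" using image_mono[OF assms(3), of \<pi>] by (simp add: permutes_image[OF assms(1)])
  then show ?thesis using assms(2) unfolding cube_map_def by blast
qed

lemma cube_map_eqI:
  assumes p: "\<pi> permutes A" and sub: "u \<subseteq> A" "c \<subseteq> A" "v \<subseteq> A"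
    and eq: "\<And>j. j \<in> A \<Longrightarrow> \<pi> j \<in> u \<longleftrightarrow> (j \<in> v) \<noteq> (\<pi> j \<in> c)"
  shows "u = cube_map \<pi> c v"
proof -
  have "x \<in> u \<longleftrightarrow> x \<in> cube_map \<pi> c v" if xA: "x \<in> A" for x
  proof -
    obtain j where j: "j \<in> A" and x: "x = \<pi> j" by (rule permutes_imageE[OF p xA])
    show ?thesis unfolding x eq[OF j] cube_map_mem[OF p] ..
  qed
  then show ?thesis using sub(1) cube_map_subset[OF p sub(2,3)] by blast
qed

lemma inj_cube_map:
  assumes "\<pi> permutes A"
  shows "inj (cube_map \<pi> c)"
proof (rule injI)
  fix u v assume "cube_map \<pi> c u = cube_map \<pi> c v"
  then have "j \<in> u \<longleftrightarrow> j \<in> v" for j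
    using cube_map_mem[OF assms, of j c u] cube_map_mem[OF assms, of j c v] by auto
  then show "u = v" by blast
qed

lemma bit_bij_eq: "bij \<psi> \<Longrightarrow> \<psi> x = x + \<psi> (0::bit)"
proof -
  assume "bij \<psi>"
  then have "\<psi> 0 \<noteq> \<psi> 1" by (metis bij_is_inj injD zero_neq_one)
  then show ?thesis by (cases x; cases "\<psi> 0"; cases "\<psi> 1") auto
qed

lemma symmetry_iff_rows:
  assumes X: "X \<in> carrier_mat m n" and s: "\<sigma> permutes {..<m}" and p: "\<pi> permutes {..<n}"
  shows "row_permute \<sigma> X = apply_permaut X (\<pi>, \<psi>) \<longleftrightarrow>
    (\<forall>i<m. \<forall>j<n. X $$ (i, \<pi> j) = \<psi> j (X $$ (\<sigma> i, j)))"
proof -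
  have d: "dim_row X = m" "dim_col X = n" using X by auto
  have "row_permute \<sigma> X = apply_permaut X (\<pi>, \<psi>) \<longleftrightarrow>
    (\<forall>i\<in>{..<m}. \<forall>j\<in>{..<n}. X $$ (inv_into UNIV \<sigma> i, j) = \<psi> (inv_into UNIV \<pi> j) (X $$ (i, inv_into UNIV \<pi> j)))"
    by (auto simp: row_permute_def apply_permaut_def d mat_eq_iff)
  also have "\<dots> \<longleftrightarrow> (\<forall>i\<in>\<sigma> ` {..<m}. \<forall>j\<in>\<pi> ` {..<n}. X $$ (inv_into UNIV \<sigma> i, j) = \<psi> (inv_into UNIV \<pi> j) (X $$ (i, inv_into UNIV \<pi> j)))"
    using s p by (simp add: permutes_image)
  also have "\<dots> \<longleftrightarrow> (\<forall>i<m. \<forall>j<n. X $$ (i, \<pi> j) = \<psi> j (X $$ (\<sigma> i, j)))"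
    using s p by (auto simp: permutes_inverses)
  finally show ?thesis .
qed

text \<open>
  On two elements a bijection is the addition of a constant, so the family \<open>\<psi>\<close> of a column
  permaut is the set \<open>c\<close> of flipped columns, here named after their new positions. A symmetry
  then says that one automorphism of the cube sends the row \<open>\<sigma> i\<close> to the row \<open>i\<close>, for every \<open>i\<close>.
\<close>

lemma asymmetric_iff_rows:
  assumes X: "X \<in> carrier_mat m n"
  shows "asymmetric X \<longleftrightarrow> (\<forall>\<sigma> \<pi> c. \<sigma> permutes {..<m} \<and> \<pi> permutes {..<n} \<and> c \<subseteq> {..<n} \<and>
      (\<forall>i<m. row_set X i = cube_map \<pi> c (row_set X (\<sigma> i))) \<longrightarrow> \<sigma> = id \<and> \<pi> = id \<and> c = {})"
    (is "_ \<longleftrightarrow> ?R")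
proof
  have d: "dim_row X = m" "dim_col X = n" using X by auto
  have row_mem: "j \<in> row_set X i \<longleftrightarrow> X $$ (i, j) = 1" if "j < n" for i j
    using that by (simp add: row_set_def d)
  have row_sub: "row_set X i \<subseteq> {..<n}" for i by (auto simp: row_set_def d)
  {
    assume as: "asymmetric X"
    show ?R
    proof (intro allI impI, elim conjE)
      fix \<sigma> \<pi> c
      assume s: "\<sigma> permutes {..<m}" and p: "\<pi> permutes {..<n}" and c: "c \<subseteq> {..<n}"
        and eq: "\<forall>i<m. row_set X i = cube_map \<pi> c (row_set X (\<sigma> i))"
      define \<psi> where "\<psi> j x = (if \<pi> j \<in> c then x + 1 else x)" for j and x :: bit
      have bij: "bij (\<psi> j)" for j
        by (rule involuntory_imp_bij) (simp add: \<psi>_def add.assoc)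
      have "X $$ (i, \<pi> j) = \<psi> j (X $$ (\<sigma> i, j))" if "i < m" "j < n" for i j
      proof -
        have pj: "\<pi> j < n" using that(2) permutes_in_image[OF p] by simp
        have "X $$ (i, \<pi> j) = 1 \<longleftrightarrow> (X $$ (\<sigma> i, j) = 1) \<noteq> (\<pi> j \<in> c)"
          using eq that cube_map_mem[OF p] row_mem pj by metis
        then show ?thesis
          by (cases "X $$ (i, \<pi> j)"; cases "X $$ (\<sigma> i, j)") (auto simp: \<psi>_def)
      qed
      then have "matrix_symmetry X \<sigma> (\<pi>, \<psi>)"
        using s p bij symmetry_iff_rows[OF X s p]
        by (auto simp: matrix_symmetry_def d column_permaut_def)
      then have r: "\<sigma> = id" "\<pi> = id" "\<forall>j<n. \<psi> j = id"
        using as by (auto simp: asymmetric_def trivial_permaut_def d)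
      have "j \<notin> c" if "j < n" for j
      proof -
        have "\<psi> j 0 = 0" using r(3) that by simp
        then show ?thesis using r(2) by (auto simp: \<psi>_def split: if_splits)
      qed
      then show "\<sigma> = id \<and> \<pi> = id \<and> c = {}" using r c by blast
    qed
  next
    assume R: ?R
    show "asymmetric X"
      unfolding asymmetric_def
    proof (intro allI impI)
      fix \<sigma> and \<phi> :: permaut
      assume sym: "matrix_symmetry X \<sigma> \<phi>"
      obtain \<pi> \<psi> where \<phi>: "\<phi> = (\<pi>, \<psi>)" by (cases \<phi>)
      have s: "\<sigma> permutes {..<m}" and p: "\<pi> permutes {..<n}" and bij: "\<forall>j<n. bij (\<psi> j)"
        using sym by (auto simp: matrix_symmetry_def column_permaut_def d \<phi>)
      have eq: "X $$ (i, \<pi> j) = \<psi> j (X $$ (\<sigma> i, j))" if "i < m" "j < n" for i j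
        using sym symmetry_iff_rows[OF X s p] that by (auto simp: matrix_symmetry_def \<phi>)
      define c where "c = \<pi> ` {j. j < n \<and> \<psi> j 0 = 1}"
      have c: "c \<subseteq> {..<n}" using permutes_in_image[OF p] by (auto simp: c_def)
      have c_mem: "\<pi> j \<in> c \<longleftrightarrow> \<psi> j 0 = 1" if "j < n" for j
        using permutes_inj[OF p] that by (auto simp: c_def dest: injD)
      have "row_set X i = cube_map \<pi> c (row_set X (\<sigma> i))" if "i < m" for i
      proof (rule cube_map_eqI[OF p row_sub c row_sub])
        fix j assume "j \<in> {..<n}"
        then have j: "j < n" "\<pi> j < n" using permutes_in_image[OF p] by auto
        have "X $$ (i, \<pi> j) = X $$ (\<sigma> i, j) + \<psi> j 0"
          using eq[OF that j(1)] bit_bij_eq bij j(1) by metis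
        then show "\<pi> j \<in> row_set X i \<longleftrightarrow> (j \<in> row_set X (\<sigma> i)) \<noteq> (\<pi> j \<in> c)"
          using j by (cases "X $$ (\<sigma> i, j)"; cases "\<psi> j 0") (auto simp: row_mem c_mem)
      qed
      then have r: "\<sigma> = id" "\<pi> = id" "c = {}" using R s p c by blast+
      have "\<psi> j = id" if "j < n" for j
      proof
        fix x
        have "\<psi> j 0 = 0" using c_mem[OF that] r by (cases "\<psi> j 0") auto
        then show "\<psi> j x = id x" using bit_bij_eq bij that by (metis add.right_neutral id_apply)
      qed
      then show "\<sigma> = id \<and> trivial_permaut (dim_col X) \<phi>"
        using r by (simp add: trivial_permaut_def \<phi> d)
    qed
  }
qed

text \<open>
  Equal rows could be exchanged, so the rows of an asymmetric matrix form a set of vertices, and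
  a symmetry is determined by the automorphism of the cube that it uses.
\<close>

lemma has_asymmetric_iff_rigid:
  "has_asymmetric m n \<longleftrightarrow> (\<exists>S. S \<subseteq> Pow {..<n} \<and> card S = m \<and> rigid n S)"
proof
  assume "has_asymmetric m n"
  then obtain X where X: "X \<in> carrier_mat m n" and as: "asymmetric X"
    by (auto simp: has_asymmetric_def)
  let ?r = "row_set X"
  have sub: "?r ` {..<m} \<subseteq> Pow {..<n}" using X by (auto simp: row_set_def)
  note R = as[unfolded asymmetric_iff_rows[OF X], rule_format]
  have inj: "inj_on ?r {..<m}"
  proof (rule inj_onI, rule ccontr)
    fix i k assume ik: "i \<in> {..<m}" "k \<in> {..<m}" "?r i = ?r k" "i \<noteq> k"
    have "transpose i k = id"
      using R[of "transpose i k" id "{}"] ik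
      by (auto simp: permutes_swap_id permutes_id cube_map_def transpose_def)
    then show False using ik(4) by (metis id_apply transpose_apply_first)
  qed
  have "rigid n (?r ` {..<m})"
    unfolding rigid_def
  proof (intro allI impI, elim conjE)
    fix \<pi> c assume p: "\<pi> permutes {..<n}" and c: "c \<subseteq> {..<n}"
      and img: "cube_map \<pi> c ` ?r ` {..<m} = ?r ` {..<m}"
    obtain \<sigma> where s: "\<sigma> permutes {..<m}" and eq: "\<And>i. i < m \<Longrightarrow> ?r i = cube_map \<pi> c (?r (\<sigma> i))"
      using index_permutation[OF inj img] by blast
    show "\<pi> = id \<and> c = {}" using R[of \<sigma> \<pi> c] s eq p c by blast
  qed
  then show "\<exists>S. S \<subseteq> Pow {..<n} \<and> card S = m \<and> rigid n S"
    using sub card_image[OF inj] by (intro exI[of _ "?r ` {..<m}"]) simp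
next
  assume "\<exists>S. S \<subseteq> Pow {..<n} \<and> card S = m \<and> rigid n S"
  then obtain S where S: "S \<subseteq> Pow {..<n}" "card S = m" "rigid n S" by blast
  have "finite S" using S(1) finite_subset by blast
  then obtain r where r: "bij_betw r {..<m} S"
    using S(2) ex_bij_betw_nat_finite[of S] by (auto simp: atLeast0LessThan)
  define X :: "bit mat" where "X = mat m n (\<lambda>(i, j). if j \<in> r i then 1 else 0)"
  have X: "X \<in> carrier_mat m n" by (simp add: X_def)
  have row: "row_set X i = r i" if "i < m" for i
  proof -
    have "r i \<subseteq> {..<n}" using S(1) r that by (auto simp: bij_betw_def)
    then show ?thesis using that by (auto simp: row_set_def X_def split: if_splits)
  qed
  have "asymmetric X"
    unfolding asymmetric_iff_rows[OF X]
  proof (intro allI impI, elim conjE)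
    fix \<sigma> \<pi> c assume s: "\<sigma> permutes {..<m}" and p: "\<pi> permutes {..<n}" and c: "c \<subseteq> {..<n}"
      and eq: "\<forall>i<m. row_set X i = cube_map \<pi> c (row_set X (\<sigma> i))"
    have s_lt: "\<sigma> i < m" if "i < m" for i using permutes_in_image[OF s] that by simp
    have eq': "r i = cube_map \<pi> c (r (\<sigma> i))" if "i < m" for i using eq row s_lt that by simp
    have "cube_map \<pi> c ` S = cube_map \<pi> c ` r ` \<sigma> ` {..<m}"
      using r permutes_image[OF s] by (simp add: bij_betw_def)
    also have "\<dots> = r ` {..<m}" using eq' by (simp add: image_image)
    finally have "cube_map \<pi> c ` S = S" using r by (simp add: bij_betw_def)
    then have pc: "\<pi> = id" "c = {}" using S(3) p c by (auto simp: rigid_def)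
    have "\<sigma> i = i" for i
    proof (cases "i < m")
      case True
      then have "r i = r (\<sigma> i)" using eq' pc by (simp add: cube_map_def)
      then show ?thesis using r True s_lt by (metis bij_betw_def inj_on_eq_iff lessThan_iff)
    next
      case False
      then show ?thesis using permutes_not_in[OF s] by simp
    qed
    then show "\<sigma> = id \<and> \<pi> = id \<and> c = {}" using pc by auto
  qed
  then show "has_asymmetric m n" using X by (auto simp: has_asymmetric_def)
qed

section \<open>Columns as splits of the rows\<close>

text \<open>
  A column splits the rows \<open>{..<m}\<close> into two sides. Flipping the column exchanges the sides, so
  either of them describes the split. Families of splits list each split by the side without row
  \<open>0\<close>, as a subset of \<open>{1..<m}\<close>; with this choice distinct members are distinct splits.
\<close>

definition same_split :: "nat \<Rightarrow> nat set \<Rightarrow> nat set \<Rightarrow> bool" where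
  "same_split m A B \<longleftrightarrow> B = A \<or> B = {..<m} - A"

definition split_rigid :: "nat \<Rightarrow> nat set set \<Rightarrow> bool" where
  "split_rigid m F \<longleftrightarrow>
    (\<forall>\<sigma>. \<sigma> permutes {..<m} \<and> (\<forall>A\<in>F. \<exists>B\<in>F. same_split m (\<sigma> ` A) B) \<longrightarrow> \<sigma> = id)"

lemma same_splitI:
  assumes s: "\<sigma> permutes {..<m}" and sub: "A \<subseteq> {..<m}" "B \<subseteq> {..<m}"
    and eq: "\<And>i. i < m \<Longrightarrow> \<sigma> i \<in> B \<longleftrightarrow> (i \<in> A) \<noteq> e"
  shows "same_split m (\<sigma> ` A) B"
proof -
  have img: "\<sigma> i \<in> \<sigma> ` A \<longleftrightarrow> i \<in> A" for i
    using permutes_inj[OF s] by (simp add: inj_image_mem_iff)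
  have "\<sigma> ` A \<subseteq> \<sigma> ` {..<m}" by (rule image_mono[OF sub(1)])
  then have sub': "\<sigma> ` A \<subseteq> {..<m}" by (simp only: permutes_image[OF s])
  have *: "x \<in> B \<longleftrightarrow> (x \<in> \<sigma> ` A) \<noteq> e" if x: "x < m" for x
  proof -
    obtain i where "i \<in> {..<m}" "x = \<sigma> i"
      by (rule permutes_imageE[OF s, of x]) (use x in simp_all)
    then show ?thesis using eq[of i] img by simp
  qed
  show ?thesis
  proof (cases e)
    case True
    have "B = {..<m} - \<sigma> ` A" using * True sub(2) by auto
    then show ?thesis by (simp add: same_split_def)
  next
    case False
    have "B = \<sigma> ` A" using * False sub(2) sub' by blast
    then show ?thesis by (simp add: same_split_def)
  qed
qed

lemma same_split_mem:
  assumes s: "\<sigma> permutes {..<m}" and eq: "same_split m (\<sigma> ` A) B"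
  obtains e where "\<And>i. i < m \<Longrightarrow> \<sigma> i \<in> B \<longleftrightarrow> (i \<in> A) \<noteq> e"
proof (rule that[of "B \<noteq> \<sigma> ` A"])
  fix i assume "i < m"
  then have lt: "\<sigma> i < m" using permutes_in_image[OF s, of i] by simp
  have img: "\<sigma> i \<in> \<sigma> ` A \<longleftrightarrow> i \<in> A"
    using permutes_inj[OF s] by (simp add: inj_image_mem_iff)
  show "\<sigma> i \<in> B \<longleftrightarrow> (i \<in> A) \<noteq> (B \<noteq> \<sigma> ` A)"
  proof (cases "B = \<sigma> ` A")
    case True
    then show ?thesis using img by simp
  next
    case False
    then have "B = {..<m} - \<sigma> ` A" using eq by (simp add: same_split_def)
    then show ?thesis using False img lt by simp
  qed
qed

text \<open>
  The vertex \<open>v i\<close> is row \<open>i\<close> of the matrix whose columns are the members of \<open>F\<close>. If an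
  automorphism preserves the set of rows, then the permutation of rows that it induces maps
  columns to columns up to complement, hence it is the identity. Row \<open>0\<close> is \<open>{}\<close>, so no column
  is flipped, and no column is moved because the columns are distinct.
\<close>

lemma rigid_rows_of_split_rigid:
  assumes F: "F \<subseteq> Pow {1..<m}" and m: "1 \<le> m" and rig: "split_rigid m F"
    and f: "bij_betw f {..<n} F"
    and v: "\<And>i. v i = {j. j < n \<and> i \<in> f j}"
  shows "inj_on v {..<m}" "rigid n (v ` {..<m})"
proof -
  have fF: "f j \<in> F" if "j < n" for j using f that by (auto simp: bij_betw_def)
  have fsub: "f j \<subseteq> {..<m}" "0 \<notin> f j" if "j < n" for j
  proof -
    have "f j \<subseteq> {1..<m}" using F fF[OF that] by blast
    then show "f j \<subseteq> {..<m}" "0 \<notin> f j" by auto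
  qed
  show inj: "inj_on v {..<m}"
  proof (rule inj_onI, rule ccontr)
    fix i k assume ik: "i \<in> {..<m}" "k \<in> {..<m}" "v i = v k" "i \<noteq> k"
    have "transpose i k ` A = A" if A: "A \<in> F" for A
    proof -
      obtain j where j: "j < n" "A = f j" using f A by (auto simp: bij_betw_def)
      then have "i \<in> A \<longleftrightarrow> k \<in> A" using ik(3) v by blast
      then show ?thesis by (cases "i \<in> A") (auto simp: transpose_def image_iff)
    qed
    then have "\<forall>A\<in>F. \<exists>B\<in>F. same_split m (transpose i k ` A) B"
      by (simp add: same_split_def) metis
    moreover have "transpose i k permutes {..<m}" using ik by (simp add: permutes_swap_id)
    ultimately have "transpose i k = id" using rig unfolding split_rigid_def by blast
    then show False using ik(4) by (metis id_apply transpose_apply_first)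
  qed
  show "rigid n (v ` {..<m})"
    unfolding rigid_def
  proof (intro allI impI, elim conjE)
    fix \<pi> c assume p: "\<pi> permutes {..<n}" and c: "c \<subseteq> {..<n}"
      and img: "cube_map \<pi> c ` v ` {..<m} = v ` {..<m}"
    obtain \<sigma> where s: "\<sigma> permutes {..<m}" and eq: "\<And>i. i < m \<Longrightarrow> v i = cube_map \<pi> c (v (\<sigma> i))"
      using index_permutation[OF inj img] by blast
    have lt: "\<pi> j < n" if "j < n" for j using permutes_in_image[OF p, of j] that by simp
    have mem: "i \<in> f (\<pi> j) \<longleftrightarrow> (\<sigma> i \<in> f j) \<noteq> (\<pi> j \<in> c)" if "i < m" "j < n" for i j
      using cube_map_mem[OF p, of j c "v (\<sigma> i)"] eq[OF that(1)] v that(2) lt[OF that(2)] by auto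
    have "\<exists>B\<in>F. same_split m (\<sigma> ` A) B" if A: "A \<in> F" for A
    proof -
      obtain k where k: "k < n" "A = f k" using f A by (auto simp: bij_betw_def)
      obtain j where "j \<in> {..<n}" and j': "k = \<pi> j"
        by (rule permutes_imageE[OF p, of k]) (use k(1) in simp_all)
      then have j: "j < n" "k = \<pi> j" by auto
      have "same_split m (\<sigma> ` A) (f j)"
        using mem[OF _ j(1)] k j fsub
        by (intro same_splitI[OF s, where e = "\<pi> j \<in> c"]) auto
      then show ?thesis using fF[OF j(1)] by blast
    qed
    then have id: "\<sigma> = id" using rig s by (auto simp: split_rigid_def)
    have c_mem: "\<pi> j \<notin> c" if "j < n" for j
      using mem[of 0 j] id m that fsub[OF lt[OF that]] fsub[OF that] by auto
    have "f (\<pi> j) = f j" if "j < n" for j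
      using mem[OF _ that] id c_mem[OF that] fsub[OF that] fsub[OF lt[OF that]] by auto
    then have "\<pi> j = j" if "j < n" for j
      using that lt f by (metis bij_betw_def inj_on_eq_iff lessThan_iff)
    then have "\<pi> = id" using permutes_not_in[OF p] by (metis eq_id_iff lessThan_iff)
    moreover have "c = {}" using c_mem c \<open>\<pi> = id\<close> by auto
    ultimately show "\<pi> = id \<and> c = {}" ..
  qed
qed

text \<open>
  Two columns that are equal up to complement could be exchanged, so the columns of a rigid set
  are distinct as splits. A row permutation that preserves the set of splits moves the columns
  by a permutation \<open>g\<close>, and the flips can be read off from any one row.
\<close>

lemma split_rigid_of_rigid:
  assumes S: "S \<subseteq> Pow {..<n}" "card S = m" and rig: "rigid n S" and m: "1 \<le> m"
  obtains F where "F \<subseteq> Pow {1..<m}" "card F = n" "split_rigid m F"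
proof -
  have "finite S" using S(1) finite_subset by blast
  then obtain r where r: "bij_betw r {..<m} S"
    using S(2) ex_bij_betw_nat_finite[of S] by (auto simp: atLeast0LessThan)
  have r_sub: "r i \<subseteq> {..<n}" if "i < m" for i using S(1) r that by (auto simp: bij_betw_def)
  have r_inj: "inj_on r {..<m}" using r by (simp add: bij_betw_def)
  have r_img: "S = r ` {..<m}" using r by (simp add: bij_betw_def)
  define f where "f j = {i. i < m \<and> (j \<in> r i) \<noteq> (j \<in> r 0)}" for j
  have f_sub: "f j \<subseteq> {..<m}" for j by (auto simp: f_def)
  have f_zero: "0 \<notin> f j" for j by (simp add: f_def)
  have f_inj: "inj_on f {..<n}"
  proof (rule inj_onI, rule ccontr)
    fix j k assume jk: "j \<in> {..<n}" "k \<in> {..<n}" "f j = f k" "j \<noteq> k"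
    \<comment> \<open>exchange the columns, and flip both if they are complementary\<close>
    define c where "c = (if (j \<in> r 0) = (k \<in> r 0) then {} else {j, k})"
    have p: "transpose j k permutes {..<n}" using jk by (simp add: permutes_swap_id)
    have c: "c \<subseteq> {..<n}" using jk by (auto simp: c_def)
    have "cube_map (transpose j k) c (r i) = r i" if "i < m" for i
    proof (rule cube_map_eqI[OF p r_sub[OF that] c r_sub[OF that], symmetric])
      fix x
      have "(j \<in> r i) \<noteq> (j \<in> r 0) \<longleftrightarrow> (k \<in> r i) \<noteq> (k \<in> r 0)"
        using jk(3) that unfolding f_def by blast
      then show "transpose j k x \<in> r i \<longleftrightarrow> (x \<in> r i) \<noteq> (transpose j k x \<in> c)"
        by (auto simp: c_def transpose_def)
    qed
    then have "cube_map (transpose j k) c ` S = S" by (simp add: r_img image_image)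
    then have "transpose j k = id" using rig p c by (auto simp: rigid_def)
    then show False using jk(4) by (metis id_apply transpose_apply_first)
  qed
  have "split_rigid m (f ` {..<n})"
    unfolding split_rigid_def
  proof (intro allI impI, elim conjE)
    fix \<sigma> assume s: "\<sigma> permutes {..<m}"
      and pres: "\<forall>A\<in>f ` {..<n}. \<exists>B\<in>f ` {..<n}. same_split m (\<sigma> ` A) B"
    have s_lt: "\<sigma> i < m" if "i < m" for i using permutes_in_image[OF s, of i] that by simp
    have ex: "\<exists>k. k < n \<and> same_split m (\<sigma> ` f j) (f k)" if "j < n" for j
      using pres that by auto
    define g where "g j = (if j < n then SOME k. k < n \<and> same_split m (\<sigma> ` f j) (f k) else j)" for j
    have g: "g j < n \<and> same_split m (\<sigma> ` f j) (f (g j))" if "j < n" for j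
      using someI_ex[OF ex[OF that]] that by (simp add: g_def)
    have "inj_on g {..<n}"
    proof (rule inj_onI)
      fix j k assume "j \<in> {..<n}" "k \<in> {..<n}" and jk: "g j = g k"
      then have lt: "j < n" "k < n" by auto
      obtain e where e: "\<And>i. i < m \<Longrightarrow> \<sigma> i \<in> f (g j) \<longleftrightarrow> (i \<in> f j) \<noteq> e"
        using same_split_mem[OF s] g[OF lt(1)] by blast
      obtain d where d: "\<And>i. i < m \<Longrightarrow> \<sigma> i \<in> f (g k) \<longleftrightarrow> (i \<in> f k) \<noteq> d"
        using same_split_mem[OF s] g[OF lt(2)] by blast
      have "e = d" using e[of 0] d[of 0] jk m f_zero by auto
      then have "i \<in> f j \<longleftrightarrow> i \<in> f k" if "i < m" for i using e[OF that] d[OF that] jk by auto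
      then have "f j = f k" using f_sub by blast
      then show "j = k" using f_inj lt by (simp add: inj_on_eq_iff)
    qed
    moreover have "g ` {..<n} \<subseteq> {..<n}" using g by auto
    ultimately have "bij_betw g {..<n} {..<n}"
      using endo_inj_surj[of "{..<n}" g] by (simp add: bij_betw_def)
    then have p: "g permutes {..<n}" by (rule bij_imp_permutes) (simp add: g_def)
    \<comment> \<open>whether a column is flipped is decided by row 0 and its image\<close>
    define c where "c = g ` {j. j < n \<and> (j \<in> r 0) \<noteq> (g j \<in> r (\<sigma> 0))}"
    have c: "c \<subseteq> {..<n}" using g by (auto simp: c_def)
    have c_mem: "g j \<in> c \<longleftrightarrow> (j \<in> r 0) \<noteq> (g j \<in> r (\<sigma> 0))" if "j < n" for j
      using permutes_inj[OF p] that by (auto simp: c_def dest: injD)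
    have eq: "r (\<sigma> i) = cube_map g c (r i)" if "i < m" for i
    proof (rule cube_map_eqI[OF p r_sub[OF s_lt[OF that]] c r_sub[OF that]])
      fix j assume "j \<in> {..<n}"
      then have j: "j < n" by simp
      obtain e where e: "\<And>i. i < m \<Longrightarrow> \<sigma> i \<in> f (g j) \<longleftrightarrow> (i \<in> f j) \<noteq> e"
        using same_split_mem[OF s] g[OF j] by blast
      have "(g j \<in> r (\<sigma> i)) \<noteq> (g j \<in> r 0) \<longleftrightarrow> ((j \<in> r i) \<noteq> (j \<in> r 0)) \<noteq> e"
        using e[OF that] s_lt[OF that] that by (simp add: f_def)
      moreover have "(g j \<in> r (\<sigma> 0)) \<noteq> (g j \<in> r 0) \<longleftrightarrow> e"
        using e[of 0] s_lt[of 0] m by (simp add: f_def)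
      ultimately show "g j \<in> r (\<sigma> i) \<longleftrightarrow> (j \<in> r i) \<noteq> (g j \<in> c)"
        using c_mem[OF j] by blast
    qed
    have "cube_map g c ` S = r ` \<sigma> ` {..<m}"
      unfolding r_img image_image using eq by (intro image_cong) auto
    also have "\<dots> = S" unfolding r_img by (simp only: permutes_image[OF s])
    finally have gc: "g = id" "c = {}" using rig p c by (auto simp: rigid_def)
    have "\<sigma> i = i" for i
    proof (cases "i < m")
      case True
      then have "r (\<sigma> i) = r i" using eq gc by (simp add: cube_map_def)
      then show ?thesis using r_inj True s_lt by (simp add: inj_on_eq_iff)
    next
      case False
      then show ?thesis using permutes_not_in[OF s] by simp
    qed
    then show "\<sigma> = id" by auto
  qed
  moreover have "f ` {..<n} \<subseteq> Pow {1..<m}"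
  proof (intro image_subsetI PowI subsetI)
    fix j i assume "i \<in> f j"
    then have "i < m" "i \<noteq> 0" using f_zero[of j] f_sub[of j] by (blast, metis)
    then show "i \<in> {1..<m}" by simp
  qed
  ultimately show thesis using that card_image[OF f_inj] by simp
qed

lemma has_asymmetric_iff_split_rigid:
  assumes m: "1 \<le> m"
  shows "has_asymmetric m n \<longleftrightarrow> (\<exists>F. F \<subseteq> Pow {1..<m} \<and> card F = n \<and> split_rigid m F)"
proof
  assume "has_asymmetric m n"
  then obtain S where S: "S \<subseteq> Pow {..<n}" "card S = m" "rigid n S"
    unfolding has_asymmetric_iff_rigid by blast
  obtain F where "F \<subseteq> Pow {1..<m}" "card F = n" "split_rigid m F"
    by (rule split_rigid_of_rigid[OF S m])
  then show "\<exists>F. F \<subseteq> Pow {1..<m} \<and> card F = n \<and> split_rigid m F" by blast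
next
  assume "\<exists>F. F \<subseteq> Pow {1..<m} \<and> card F = n \<and> split_rigid m F"
  then obtain F where F: "F \<subseteq> Pow {1..<m}" "card F = n" "split_rigid m F" by blast
  have "finite F" using F(1) finite_subset by blast
  then obtain f where f: "bij_betw f {..<n} F"
    using F(2) ex_bij_betw_nat_finite[of F] by (auto simp: atLeast0LessThan)
  define v where "v i = {j. j < n \<and> i \<in> f j}" for i
  have "inj_on v {..<m}" "rigid n (v ` {..<m})"
    using rigid_rows_of_split_rigid[OF F(1) m F(3) f v_def] by auto
  then show "has_asymmetric m n"
    unfolding has_asymmetric_iff_rigid
    by (intro exI[of _ "v ` {..<m}"]) (auto simp: card_image, simp add: v_def)
qed

text \<open>
  An automorphism preserves a set of vertices if and only if it preserves the complement of the
  set.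
\<close>

lemma has_asymmetric_complement:
  assumes "has_asymmetric m n"
  shows "m \<le> 2 ^ n" "has_asymmetric (2 ^ n - m) n"
proof -
  obtain S where S: "S \<subseteq> Pow {..<n}" "card S = m" "rigid n S"
    using assms by (auto simp: has_asymmetric_iff_rigid)
  let ?P = "Pow {..<n} :: nat set set"
  have cP: "card ?P = 2 ^ n" by (simp add: card_Pow)
  show "m \<le> 2 ^ n" using S card_mono[OF _ S(1)] cP by simp
  have "rigid n (?P - S)"
    unfolding rigid_def
  proof (intro allI impI, elim conjE)
    fix \<pi> c assume p: "\<pi> permutes {..<n}" and c: "c \<subseteq> {..<n}"
      and img: "cube_map \<pi> c ` (?P - S) = ?P - S"
    have inj: "inj (cube_map \<pi> c)" by (rule inj_cube_map[OF p])
    have "cube_map \<pi> c ` ?P \<subseteq> ?P" using cube_map_subset[OF p c] by auto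
    then have "cube_map \<pi> c ` ?P = ?P"
      using inj by (intro endo_inj_surj) (auto intro: inj_on_subset)
    moreover have "S = ?P - (?P - S)" using S(1) by blast
    ultimately have "cube_map \<pi> c ` S = S" using img image_set_diff[OF inj, of ?P "?P - S"] by simp
    then show "\<pi> = id \<and> c = {}" using S(3) p c by (auto simp: rigid_def)
  qed
  moreover have "card (?P - S) = 2 ^ n - m"
    using S(1,2) cP by (simp add: card_Diff_subset finite_subset)
  ultimately show "has_asymmetric (2 ^ n - m) n"
    unfolding has_asymmetric_iff_rigid by (intro exI[of _ "?P - S"]) simp
qed

text \<open>
  There are only \<open>2 ^ (m - 1)\<close> splits of \<open>m\<close> rows.
\<close>

lemma has_asymmetric_columns_le:
  assumes "has_asymmetric m n" "1 \<le> m"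
  shows "n \<le> 2 ^ (m - 1)"
proof -
  obtain F where "F \<subseteq> Pow {1..<m}" "card F = n"
    using assms by (auto simp: has_asymmetric_iff_split_rigid)
  then show ?thesis using card_mono[of "Pow {1..<m}" F] by (simp add: card_Pow)
qed

section \<open>At least five rows\<close>

lemma ex_same_split: "(\<exists>B\<in>F. same_split m A B) \<longleftrightarrow> A \<in> F \<or> {..<m} - A \<in> F"
  by (auto simp: same_split_def)

text \<open>
  A row is called marked here if the split that cuts it off from all others belongs to the
  family. On two or three rows only the marks matter, two of the rows agree in their marks, and
  exchanging these two is a symmetry. On four rows there are also the three splits into pairs.
  The double transpositions fix each of these, so one of them is a symmetry if the number of
  marked rows is even. Otherwise one row differs from the other three in its mark; the splits
  into pairs correspond to the partners of that row, and since two of the three partners agree,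
  exchanging these two is a symmetry. Row \<open>0\<close> is cut off by the member \<open>{1..<m}\<close>.
\<close>

lemma not_split_rigid_few_rows:
  assumes F: "F \<subseteq> Pow {1..<m}" and m: "m = 2 \<or> m = 3 \<or> m = 4"
  shows "\<not> split_rigid m F"
proof
  assume rig: "split_rigid m F"
  have no: False
    if "a < m" "b < m" "a \<noteq> b" and "\<forall>A\<in>F. \<exists>B\<in>F. same_split m (transpose a b ` A) B" for a b
  proof -
    have "transpose a b = id"
      using rig that unfolding split_rigid_def by (simp add: permutes_swap_id)
    then show False using that(3) by (metis id_apply transpose_apply_first)
  qed
  have no': False
    if "a < m" "b < m" "c < m" "d < m" "distinct [a, b, c, d]"
      and pres: "\<forall>A\<in>F. \<exists>B\<in>F. same_split m ((transpose a b \<circ> transpose c d) ` A) B" for a b c d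
  proof -
    have "transpose a b \<circ> transpose c d permutes {..<m}"
      using that by (intro permutes_compose) (simp_all add: permutes_swap_id)
    then have "transpose a b \<circ> transpose c d = id"
      using rig pres unfolding split_rigid_def by blast
    then have "(transpose a b \<circ> transpose c d) a = a" by simp
    then show False using that(5) by (simp add: transpose_def)
  qed
  consider "m = 2" | "m = 3" | "m = 4" using m by blast
  then show False
  proof cases
    case 1
    have U: "{..<2::nat} = {0, 1}" by auto
    note simps = ex_same_split transpose_def U 1 insert_Diff_if insert_commute
    have sub: "F \<subseteq> {{}, {1}}"
      using F 1 by (auto simp: numeral_eq_Suc atLeastLessThanSuc Pow_insert)
    have all: "\<forall>A\<in>F. Q A" if "{} \<in> F \<Longrightarrow> Q {}" "{1} \<in> F \<Longrightarrow> Q {1}" for Q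
      using sub that by blast
    show False by (rule no[of 0 1, OF _ _ _ all]) (simp_all add: simps)
  next
    case 2
    have U: "{..<3::nat} = {0, 1, 2}" by auto
    note simps = ex_same_split transpose_def U 2 insert_Diff_if insert_commute
    have sub: "F \<subseteq> {{}, {1}, {2}, {1, 2}}"
      using F 2 by (auto simp: numeral_eq_Suc atLeastLessThanSuc Pow_insert)
    have all: "\<forall>A\<in>F. Q A"
      if "{} \<in> F \<Longrightarrow> Q {}" "{1} \<in> F \<Longrightarrow> Q {1}" "{2} \<in> F \<Longrightarrow> Q {2}" "{1, 2} \<in> F \<Longrightarrow> Q {1, 2}" for Q
      using sub that by blast
    have t12: "\<not> ({1} \<in> F \<longleftrightarrow> {2} \<in> F)"
      by (rule notI, rule no[of 1 2, OF _ _ _ all]) (simp_all add: simps)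
    have t01: "\<not> ({1} \<in> F \<longleftrightarrow> {1, 2} \<in> F)"
      by (rule notI, rule no[of 0 1, OF _ _ _ all]) (simp_all add: simps)
    have t02: "\<not> ({2} \<in> F \<longleftrightarrow> {1, 2} \<in> F)"
      by (rule notI, rule no[of 0 2, OF _ _ _ all]) (simp_all add: simps)
    show False using t12 t01 t02 by blast
  next
    case 3
    have U: "{..<4::nat} = {0, 1, 2, 3}" by auto
    note simps = ex_same_split transpose_def U 3 insert_Diff_if insert_commute
    have "{1..<4::nat} = {1, 2, 3}" by auto
    moreover have "Pow {1, 2, 3::nat} = {{}, {1}, {2}, {3}, {1, 2}, {1, 3}, {2, 3}, {1, 2, 3}}"
      by (simp add: Pow_insert insert_commute)
    ultimately have sub: "F \<subseteq> {{}, {1}, {2}, {3}, {1, 2}, {1, 3}, {2, 3}, {1, 2, 3}}"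
      using F 3 by simp
    have all: "\<forall>A\<in>F. Q A"
      if "{} \<in> F \<Longrightarrow> Q {}" "{1} \<in> F \<Longrightarrow> Q {1}" "{2} \<in> F \<Longrightarrow> Q {2}" "{3} \<in> F \<Longrightarrow> Q {3}"
        "{1, 2} \<in> F \<Longrightarrow> Q {1, 2}" "{1, 3} \<in> F \<Longrightarrow> Q {1, 3}" "{2, 3} \<in> F \<Longrightarrow> Q {2, 3}"
        "{1, 2, 3} \<in> F \<Longrightarrow> Q {1, 2, 3}" for Q
      using sub that by blast
    have t01: "\<not> (({1, 2, 3} \<in> F \<longleftrightarrow> {1} \<in> F) \<and> ({1, 2} \<in> F \<longleftrightarrow> {1, 3} \<in> F))"
      by (rule notI, rule no[of 0 1, OF _ _ _ all]) (simp_all add: simps)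
    have t02: "\<not> (({1, 2, 3} \<in> F \<longleftrightarrow> {2} \<in> F) \<and> ({1, 2} \<in> F \<longleftrightarrow> {2, 3} \<in> F))"
      by (rule notI, rule no[of 0 2, OF _ _ _ all]) (simp_all add: simps)
    have t03: "\<not> (({1, 2, 3} \<in> F \<longleftrightarrow> {3} \<in> F) \<and> ({1, 3} \<in> F \<longleftrightarrow> {2, 3} \<in> F))"
      by (rule notI, rule no[of 0 3, OF _ _ _ all]) (simp_all add: simps)
    have t12: "\<not> (({1} \<in> F \<longleftrightarrow> {2} \<in> F) \<and> ({1, 3} \<in> F \<longleftrightarrow> {2, 3} \<in> F))"
      by (rule notI, rule no[of 1 2, OF _ _ _ all]) (simp_all add: simps)
    have t13: "\<not> (({1} \<in> F \<longleftrightarrow> {3} \<in> F) \<and> ({1, 2} \<in> F \<longleftrightarrow> {2, 3} \<in> F))"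
      by (rule notI, rule no[of 1 3, OF _ _ _ all]) (simp_all add: simps)
    have t23: "\<not> (({2} \<in> F \<longleftrightarrow> {3} \<in> F) \<and> ({1, 2} \<in> F \<longleftrightarrow> {1, 3} \<in> F))"
      by (rule notI, rule no[of 2 3, OF _ _ _ all]) (simp_all add: simps)
    have d1: "\<not> (({1, 2, 3} \<in> F \<longleftrightarrow> {1} \<in> F) \<and> ({2} \<in> F \<longleftrightarrow> {3} \<in> F))"
      by (rule notI, rule no'[of 0 1 2 3, OF _ _ _ _ _ all]) (simp_all add: simps)
    have d2: "\<not> (({1, 2, 3} \<in> F \<longleftrightarrow> {2} \<in> F) \<and> ({1} \<in> F \<longleftrightarrow> {3} \<in> F))"
      by (rule notI, rule no'[of 0 2 1 3, OF _ _ _ _ _ all]) (simp_all add: simps)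
    have d3: "\<not> (({1, 2, 3} \<in> F \<longleftrightarrow> {3} \<in> F) \<and> ({1} \<in> F \<longleftrightarrow> {2} \<in> F))"
      by (rule notI, rule no'[of 0 3 1 2, OF _ _ _ _ _ all]) (simp_all add: simps)
    show False using t01 t02 t03 t12 t13 t23 d1 d2 d3 by argo
  qed
qed

text \<open>
  With no rows a flip is a symmetry, and with one row there is at most one column.
\<close>

lemma has_asymmetric_rows_ge:
  assumes att: "has_asymmetric m n" and n: "2 \<le> n"
  shows "5 \<le> m"
proof (rule ccontr)
  assume "\<not> 5 \<le> m"
  then consider "m = 0" | "m = 1" | "m = 2 \<or> m = 3 \<or> m = 4" by linarith
  then show False
  proof cases
    case 1
    then obtain S where S: "S \<subseteq> Pow {..<n}" "card S = 0" "rigid n S"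
      using att by (auto simp: has_asymmetric_iff_rigid)
    then have "S = {}" using finite_subset[OF S(1)] by simp
    then show False using S(3) n by (auto simp: rigid_def dest!: spec[of _ id] spec[of _ "{0}"] simp: permutes_id)
  next
    case 2
    then show False using has_asymmetric_columns_le[OF att] n by simp
  next
    case 3
    then show False using att not_split_rigid_few_rows[of _ m] has_asymmetric_iff_split_rigid[of m n] by auto
  qed
qed

section \<open>Rigid families of splits from a marked path\<close>

text \<open>
  The automorphisms of a path are the identity and the reversal: a walk with unit steps that
  never turns back is monotone, and the range leaves no room to start anywhere but at an end.
\<close>

lemma unit_steps_monotone:
  fixes s :: "nat \<Rightarrow> nat"
  assumes m: "3 \<le> m"
    and step: "\<And>i. 1 \<le> i \<Longrightarrow> i + 1 < m \<Longrightarrow> s (i + 1) = s i + 1 \<or> s i = s (i + 1) + 1"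
    and turn: "\<And>i. 1 \<le> i \<Longrightarrow> i + 2 < m \<Longrightarrow> s (i + 2) \<noteq> s i"
    and range: "\<And>i. 1 \<le> i \<Longrightarrow> i < m \<Longrightarrow> 1 \<le> s i \<and> s i < m"
  shows "(\<forall>i. 1 \<le> i \<and> i < m \<longrightarrow> s i = i) \<or> (\<forall>i. 1 \<le> i \<and> i < m \<longrightarrow> s i = m - i)"
proof -
  obtain k where k: "m = k + 3" using m by (metis le_add_diff_inverse2)
  have split: "i = 1 \<or> (\<exists>j. i = j + 2)" if "1 \<le> i" for i :: nat
    using that by presburger
  consider "s 2 = s 1 + 1" | "s 1 = s 2 + 1" using step[of 1] m by (auto simp: numeral_2_eq_2)
  then show ?thesis
  proof cases
    case 1
    have up: "s (k + 1) = s 1 + k \<and> s (k + 2) = s 1 + k + 1" if "k + 2 < m" for k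
      using that
    proof (induction k)
      case 0
      then show ?case using 1 by (simp add: numeral_2_eq_2)
    next
      case (Suc k)
      then show ?case using step[of "k + 2"] turn[of "k + 1"] by (auto simp: numeral_eq_Suc)
    qed
    have "s 1 = 1" using up[of k] range[of "k + 2"] range[of 1] k by simp
    then have "s i = i" if "1 \<le> i" "i < m" for i
      using split[OF that(1)] up that(2) by auto
    then show ?thesis by blast
  next
    case 2
    have down: "s 1 = s (k + 1) + k \<and> s 1 = s (k + 2) + k + 1" if "k + 2 < m" for k
      using that
    proof (induction k)
      case 0
      then show ?case using 2 by (simp add: numeral_2_eq_2)
    next
      case (Suc k)
      then show ?case using step[of "k + 2"] turn[of "k + 1"] by (auto simp: numeral_eq_Suc)
    qed
    have s1: "s 1 = m - 1" using down[of k] range[of "k + 2"] range[of 1] k by simp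
    have "s i = m - i" if i: "1 \<le> i" "i < m" for i
    proof (cases "i = 1")
      case True
      then show ?thesis using s1 by simp
    next
      case False
      then obtain j where j: "i = j + 2" using split[OF i(1)] by blast
      then have "s 1 = s i + j + 1" using down[of j] i(2) by simp
      then show ?thesis using s1 j by simp
    qed
    then show ?thesis by blast
  qed
qed

text \<open>
  The splits into two and \<open>m - 2\<close> rows are the edges of a graph on the rows, and every symmetry
  is an automorphism of this graph. Here the graph is the path through \<open>1, \<dots>, m - 1\<close> with row
  \<open>0\<close> isolated, so the only candidate is the reversal, which would carry the split that cuts off
  \<open>a\<close> to the one that cuts off \<open>m - a\<close>. A member with \<open>m - 2\<close> elements would be an edge at row
  \<open>0\<close>. Apart from \<open>{m - a}\<close>, splits of all other sizes may be added freely; this freedom is what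
  the constructions use.
\<close>

lemma path_split_rigid:
  assumes m: "5 \<le> m" and F: "F \<subseteq> Pow {1..<m}"
    and two: "\<And>A. A \<in> F \<Longrightarrow> card A = 2 \<Longrightarrow> \<exists>i\<ge>1. i + 1 < m \<and> A = {i, i + 1}"
    and co_two: "\<And>A. A \<in> F \<Longrightarrow> card A \<noteq> m - 2"
    and edge: "\<And>i. 1 \<le> i \<Longrightarrow> i + 1 < m \<Longrightarrow> {i, i + 1} \<in> F"
    and a: "1 \<le> a" "a < m" and mark: "{a} \<in> F" "{m - a} \<notin> F"
  shows "split_rigid m F"
  unfolding split_rigid_def
proof (intro allI impI, elim conjE)
  fix \<sigma> assume s: "\<sigma> permutes {..<m}" and pres: "\<forall>A\<in>F. \<exists>B\<in>F. same_split m (\<sigma> ` A) B"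
  have inj: "\<sigma> i = \<sigma> k \<longleftrightarrow> i = k" for i k using permutes_inj[OF s] by (auto dest: injD)
  have lt: "\<sigma> i < m" if "i < m" for i using permutes_in_image[OF s, of i] that by simp
  have edge_img: "\<exists>k\<ge>1. k + 1 < m \<and> {\<sigma> i, \<sigma> (i + 1)} = {k, k + 1}" if i: "1 \<le> i" "i + 1 < m" for i
  proof -
    obtain B where B: "B \<in> F" "same_split m {\<sigma> i, \<sigma> (i + 1)} B"
      using pres edge[OF i] by fastforce
    have c2: "card {\<sigma> i, \<sigma> (i + 1)} = 2" using inj[of i "i + 1"] by simp
    have "card ({..<m} - {\<sigma> i, \<sigma> (i + 1)}) = m - 2"
      using c2 lt i by (subst card_Diff_subset) auto
    then have "B = {\<sigma> i, \<sigma> (i + 1)}" using B co_two by (auto simp: same_split_def)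
    then show ?thesis using two B(1) c2 by blast
  qed
  have step: "\<sigma> (i + 1) = \<sigma> i + 1 \<or> \<sigma> i = \<sigma> (i + 1) + 1" if "1 \<le> i" "i + 1 < m" for i
    using edge_img[OF that] by (auto simp: doubleton_eq_iff)
  have pos: "1 \<le> \<sigma> i \<and> 1 \<le> \<sigma> (i + 1)" if "1 \<le> i" "i + 1 < m" for i
    using edge_img[OF that] by (auto simp: doubleton_eq_iff)
  have range: "1 \<le> \<sigma> i \<and> \<sigma> i < m" if "1 \<le> i" "i < m" for i
  proof (cases "i + 1 < m")
    case True
    then show ?thesis using pos[of i] that lt by blast
  next
    case False
    then show ?thesis using pos[of "i - 1"] that lt m by auto
  qed
  have "(\<forall>i. 1 \<le> i \<and> i < m \<longrightarrow> \<sigma> i = i) \<or> (\<forall>i. 1 \<le> i \<and> i < m \<longrightarrow> \<sigma> i = m - i)"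
    using m step range inj by (intro unit_steps_monotone) auto
  moreover have "\<not> (\<forall>i. 1 \<le> i \<and> i < m \<longrightarrow> \<sigma> i = m - i)"
  proof
    assume "\<forall>i. 1 \<le> i \<and> i < m \<longrightarrow> \<sigma> i = m - i"
    then have sa: "\<sigma> a = m - a" using a by blast
    obtain B where B: "B \<in> F" "same_split m {m - a} B" using pres mark(1) sa by fastforce
    \<comment> \<open>the other side of the split contains row 0\<close>
    have "0 \<in> {..<m} - {m - a}" using a by auto
    moreover have "0 \<notin> B" using B(1) F by fastforce
    ultimately show False using B mark(2) by (auto simp: same_split_def)
  qed
  ultimately have fixed: "\<sigma> i = i" if "1 \<le> i" "i < m" for i using that by blast
  have "\<sigma> i = i" for i
  proof -
    consider "i = 0" | "1 \<le> i \<and> i < m" | "m \<le> i" by linarith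
    then show ?thesis
    proof cases
      case 1
      have "\<sigma> 0 = 0" using fixed[of "\<sigma> 0"] lt[of 0] inj[of "\<sigma> 0" 0] m by fastforce
      then show ?thesis using 1 by simp
    next
      case 3
      then show ?thesis using permutes_not_in[OF s] by simp
    qed (use fixed in blast)
  qed
  then show "\<sigma> = id" by auto
qed

lemma choose_two_le_power: "4 \<le> k \<Longrightarrow> (k choose 2) + 2 \<le> 2 ^ (k - 1)"
proof (induction k rule: dec_induct)
  case base
  show ?case by (simp add: choose_two)
next
  case (step k)
  have "k \<le> 2 ^ (k - 1)" using self_le_ge2_pow[of 2 "k - 1"] less_exp[of "k - 1"] step(1) by linarith
  moreover have "(Suc k choose 2) = k + (k choose 2)" by (simp add: numeral_2_eq_2)
  moreover have "(2::nat) ^ k = 2 * 2 ^ (k - 1)" using step(1) by (cases k) auto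
  ultimately show ?case using step(3) by simp
qed

lemma inj_on_edge: "inj_on (\<lambda>i::nat. {i, i + 1}) A"
  by (rule inj_onI) (simp only: doubleton_eq_iff, linarith)

text \<open>
  The frame is the path on the rows \<open>1, \<dots>, m - 1\<close> and the split that cuts off row \<open>1\<close>, which
  makes \<open>m - 1\<close> columns. Every split outside \<open>N\<close> can be added without creating a symmetry, and
  there are enough of them to reach half of all splits.
\<close>

lemma has_asymmetric_path:
  assumes m: "5 \<le> m" and n: "m - 1 \<le> n" "n \<le> 2 ^ (m - 2)"
  shows "has_asymmetric m n"
proof -
  define B where "B = insert {1} ((\<lambda>i. {i, i + 1}) ` {1..<m - 1})"
  \<comment> \<open>the splits whose presence or absence is prescribed by the frame\<close>
  define N where "N = {A. A \<subseteq> {1..<m} \<and> card A = 2} \<union> {A. A \<subseteq> {1..<m} \<and> card A = m - 2} \<union> {{1}, {m - 1}}"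
  define U where "U = Pow {1..<m} - N"
  have "{1} \<notin> (\<lambda>i::nat. {i, i + 1}) ` {1..<m - 1}" by (auto simp: doubleton_eq_iff)
  then have cB: "card B = m - 1"
    using m card_image[OF inj_on_edge, of "{1..<m - 1}"] by (simp add: B_def)
  have B_sub: "B \<subseteq> Pow {1..<m}" using m by (auto simp: B_def)
  have B_N: "B \<subseteq> N" using m by (auto simp: B_def N_def)
  have "card N \<le> (m - 1 choose 2) + (m - 1 choose (m - 2)) + 2"
  proof -
    have "card N \<le> card {A. A \<subseteq> {1..<m} \<and> card A = 2} + card {A. A \<subseteq> {1..<m} \<and> card A = m - 2}
        + card {{1}, {m - 1}}"
      unfolding N_def by (meson add_le_mono card_Un_le le_refl order_trans)
    also have "card {{1}, {m - 1}} \<le> 2" using card_insert_le_m1[of 2] by (simp add: card_insert_if)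
    finally show ?thesis by (simp add: n_subsets)
  qed
  also have "(m - 1 choose (m - 2)) = m - 1"
    using binomial_symmetric[of "m - 2" "m - 1"] m by (simp add: Suc_diff_le numeral_eq_Suc)
  finally have "card N \<le> (m - 1 choose 2) + (m - 1) + 2" .
  then have cN: "card N \<le> 2 ^ (m - 2) + (m - 1)"
  proof -
    assume "card N \<le> (m - 1 choose 2) + (m - 1) + 2"
    moreover have "(m - 1 choose 2) + 2 \<le> 2 ^ (m - 2)"
      using choose_two_le_power[of "m - 1"] m by (simp add: diff_diff_left flip: numeral_2_eq_2)
    ultimately show ?thesis by linarith
  qed
  have "N \<subseteq> Pow {1..<m}" using m by (auto simp: N_def)
  then have "card U = 2 ^ (m - 1) - card N"
    unfolding U_def by (subst card_Diff_subset) (auto simp: card_Pow finite_subset)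
  moreover have "(2::nat) ^ (m - 1) = 2 ^ (m - 2) + 2 ^ (m - 2)"
    using m by (simp add: numeral_eq_Suc flip: power_Suc mult_2)
  ultimately have "n - (m - 1) \<le> card U" using cN n(2) by linarith
  then obtain R where R: "R \<subseteq> U" "card R = n - (m - 1)" "finite R"
    by (rule obtain_subset_with_card_n)
  have R_N: "A \<notin> N" "A \<subseteq> {1..<m}" if "A \<in> R" for A using R(1) that by (auto simp: U_def)
  have R_two: "card A \<noteq> 2" "card A \<noteq> m - 2" "A \<noteq> {m - 1}" if "A \<in> R" for A
    using R_N[OF that] by (auto simp: N_def)
  have "card (B \<union> R) = n"
    using card_Un_disjoint[of B R] R cB n(1) B_N R_N(1) finite_subset[OF B_sub] by fastforce
  moreover have BR: "B \<union> R \<subseteq> Pow {1..<m}" using B_sub R_N by blast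
  moreover have "split_rigid m (B \<union> R)"
  proof (rule path_split_rigid[OF m BR, where a = 1])
    fix A assume "A \<in> B \<union> R" "card A = 2"
    then have "A \<in> B" "A \<noteq> {1}" using R_two(1) by auto
    then obtain i where "i \<in> {1..<m - 1}" "A = {i, i + 1}" unfolding B_def by blast
    then show "\<exists>i\<ge>1. i + 1 < m \<and> A = {i, i + 1}" by (intro exI[of _ i]) auto
  next
    fix A assume A: "A \<in> B \<union> R"
    have "card A \<le> 2" if "A \<in> B" using that by (auto simp: B_def)
    then show "card A \<noteq> m - 2" using A R_two(2) m by fastforce
  next
    have "{m - 1} \<notin> B" using m by (auto simp: B_def)
    then show "{m - 1} \<notin> B \<union> R" using R_two(3) by blast
  qed (use m in \<open>auto simp: B_def\<close>)
  ultimately show ?thesis using has_asymmetric_iff_split_rigid[of m n] m by auto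
qed

section \<open>Rigid sets with an even frame\<close>

lemma card_sym_diff:
  assumes "finite A" "finite B"
  shows "card (sym_diff A B) + 2 * card (A \<inter> B) = card A + card B"
proof -
  have "card (sym_diff A B) = card (A - B) + card (B - A)"
    using assms by (intro card_Un_disjoint) auto
  then show ?thesis
    using card_Diff_subset_Int[of A B] card_Diff_subset_Int[of B A] card_mono[of A "A \<inter> B"] card_mono[of B "A \<inter> B"] assms
    by (simp add: Int_commute)
qed

lemma card_cube_map:
  assumes p: "\<pi> permutes {..<n}" and sub: "c \<subseteq> {..<n}" "v \<subseteq> {..<n}"
  shows "even (card (cube_map \<pi> c v)) \<longleftrightarrow> even (card v + card c)"
    and "card v \<le> card (cube_map \<pi> c v) + card c"
proof -
  have fin: "finite (\<pi> ` v)" "finite c"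
    using finite_subset[OF sub(2)] finite_subset[OF sub(1)] by simp_all
  have "card (\<pi> ` v) = card v" using permutes_inj[OF p] by (simp add: card_image inj_on_subset)
  then have eq: "card (cube_map \<pi> c v) + 2 * card (\<pi> ` v \<inter> c) = card v + card c"
    using card_sym_diff[OF fin] by (simp add: cube_map_def)
  then show "even (card (cube_map \<pi> c v)) \<longleftrightarrow> even (card v + card c)"
    by (metis dvd_triv_left even_add)
  show "card v \<le> card (cube_map \<pi> c v) + card c"
    using eq card_mono[OF fin(2), of "\<pi> ` v \<inter> c"] by simp
qed

lemma card_odd_subsets:
  assumes "1 \<le> n"
  shows "card {A. A \<subseteq> {..<n::nat} \<and> odd (card A)} = 2 ^ (n - 1)"
proof -
  let ?O = "{A. A \<subseteq> {..<n} \<and> odd (card A)}" and ?E = "{A. A \<subseteq> {..<n} \<and> even (card A)}"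
  have "0 \<in> {..<n}" using assms by simp
  then have "{} \<subset> {..<n}" by blast
  then have "card ?E = card ?O" using card_subsupersets_even_odd[of "{..<n}" "{}"] by simp
  moreover have "card (?E \<union> ?O) = card ?E + card ?O" by (rule card_Un_disjoint) auto
  moreover have "?E \<union> ?O = Pow {..<n}" by auto
  ultimately have "2 * card ?O = 2 ^ n" by (simp add: card_Pow)
  then show ?thesis using assms by (cases n) auto
qed

text \<open>
  An automorphism either preserves the parity of all vertices or changes it everywhere. In the
  first case it maps the even part \<open>S\<close> to itself, so the odd vertices that are added are
  arbitrary. In the second case it exchanges the even and the odd part, which must have the same
  size; if that size occurs, the odd part is chosen to be the set of singletons, whose mutual
  distances are at most \<open>2\<close>, whereas \<open>S\<close> contains two vertices further apart.
\<close>

lemma has_asymmetric_even_frame: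
  assumes S: "S \<subseteq> Pow {..<n}" "rigid n S" "card S = n" and even: "\<And>v. v \<in> S \<Longrightarrow> even (card v)"
    and zero: "{} \<in> S" and far: "u \<in> S" "2 < card u"
    and k: "k \<le> 2 ^ (n - 1)"
  shows "has_asymmetric (n + k) n"
proof -
  have finS: "finite S" using S(1) finite_subset by blast
  have n1: "1 \<le> n" using zero S(3) finS card_gt_0_iff[of S] by auto
  obtain E where E: "E \<subseteq> Pow {..<n}" "card E = k" "\<And>v. v \<in> E \<Longrightarrow> odd (card v)"
    and Ek: "k = n \<Longrightarrow> E = (\<lambda>j. {j}) ` {..<n}"
  proof (cases "k = n")
    case True
    have "card ((\<lambda>j. {j}) ` {..<n}) = n" by (simp add: card_image inj_on_def)
    then show ?thesis by (intro that[of "(\<lambda>j. {j}) ` {..<n}"]) (use True in auto)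
  next
    case False
    have "k \<le> card {A. A \<subseteq> {..<n} \<and> odd (card A)}" using card_odd_subsets[OF n1] k by linarith
    then obtain E where "E \<subseteq> {A. A \<subseteq> {..<n} \<and> odd (card A)}" "card E = k"
      by (rule obtain_subset_with_card_n)
    then show ?thesis by (intro that[of E]) (use False in auto)
  qed
  have finE: "finite E" using E(1) finite_subset by blast
  have disj: "S \<inter> E = {}" using even E(3) by blast
  have "rigid n (S \<union> E)"
    unfolding rigid_def
  proof (intro allI impI, elim conjE)
    fix \<pi> c assume p: "\<pi> permutes {..<n}" and c: "c \<subseteq> {..<n}" and img: "cube_map \<pi> c ` (S \<union> E) = S \<union> E"
    have inj: "inj_on (cube_map \<pi> c) T" for T using inj_cube_map[OF p] inj_on_subset by blast
    have in_img: "cube_map \<pi> c v \<in> S \<union> E" if "v \<in> S \<union> E" for v using img that by blast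
    have par: "even (card (cube_map \<pi> c v)) \<longleftrightarrow> even (card v + card c)" if "v \<in> S \<union> E" for v
      using card_cube_map(1)[OF p c] that S(1) E(1) by blast
    show "\<pi> = id \<and> c = {}"
    proof (cases "even (card c)")
      case True
      have "cube_map \<pi> c ` S \<subseteq> S"
      proof (rule image_subsetI)
        fix v assume v: "v \<in> S"
        then have "even (card (cube_map \<pi> c v))" using par even True by simp
        then show "cube_map \<pi> c v \<in> S" using in_img[of v] v E(3) by blast
      qed
      then have "cube_map \<pi> c ` S = S" using endo_inj_surj[OF finS _ inj] by blast
      then show ?thesis using S(2) p c unfolding rigid_def by blast
    next
      case False
      have SE: "cube_map \<pi> c v \<in> E" if "v \<in> S" for v
      proof -
        have "odd (card (cube_map \<pi> c v))" using par[of v] even that False by simp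
        then show ?thesis using in_img[of v] that even by blast
      qed
      have ES: "cube_map \<pi> c v \<in> S" if "v \<in> E" for v
      proof -
        have "even (card (cube_map \<pi> c v))" using par[of v] E(3) that False by simp
        then show ?thesis using in_img[of v] that E(3) by blast
      qed
      have "card S \<le> card E" using card_inj_on_le[OF inj _ finE] SE by blast
      moreover have "card E \<le> card S" using card_inj_on_le[OF inj _ finS] ES by blast
      ultimately have "E = (\<lambda>j. {j}) ` {..<n}" using Ek S(3) E(2) by simp
      then have card1: "card v = 1" if "v \<in> E" for v using that by auto
      \<comment> \<open>the images of {} and u would be singletons, at distance card u > 2\<close>
      have "cube_map \<pi> c {} = c" by (simp add: cube_map_def)
      then have "card c = 1" using SE[OF zero] card1 by metis
      moreover have "card (cube_map \<pi> c u) = 1" using SE[OF far(1)] card1 by blast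
      moreover have "card u \<le> card (cube_map \<pi> c u) + card c"
        using card_cube_map(2)[OF p c] far(1) S(1) by blast
      ultimately show ?thesis using far(2) by simp
    qed
  qed
  moreover have "card (S \<union> E) = n + k" using card_Un_disjoint[OF finS finE disj] S(3) E(2) by simp
  moreover have "S \<union> E \<subseteq> Pow {..<n}" using S(1) E(1) by blast
  ultimately show ?thesis unfolding has_asymmetric_iff_rigid by blast
qed

text \<open>
  An even rigid set of \<open>n\<close> vertices is the set of rows of a rigid family of \<open>n\<close> splits of \<open>n\<close>
  rows in which every row lies in an even number of members. The edges of the path through
  \<open>1, \<dots>, n - 1\<close> meet the two ends once and the inner rows twice. The mark \<open>{2}\<close> breaks the
  reversal, and \<open>{1, 2, n - 1}\<close> restores the parity at \<open>1\<close>, \<open>2\<close> and \<open>n - 1\<close>. The bound \<open>6 \<le> n\<close>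
  ensures that this last split is not taken for an edge.
\<close>

lemma has_asymmetric_large:
  assumes n: "6 \<le> n" and k: "k \<le> 2 ^ (n - 1)"
  shows "has_asymmetric (n + k) n"
proof -
  define P where "P = (\<lambda>i. {i, i + 1}) ` {1..<n - 1}"
  define F where "F = insert {2} (insert {1, 2, n - 1} P)"
  have n': "1 \<le> n" "5 \<le> n" using n by auto
  have P2: "card A = 2" if "A \<in> P" for A using that by (auto simp: P_def)
  have W3: "card {1, 2, n - 1} = 3" using n by simp
  have finP: "finite P" by (simp add: P_def)
  have "card P = n - 2" unfolding P_def
    by (simp only: card_image[OF inj_on_edge]) simp
  moreover have W_P: "{1, 2, n - 1} \<notin> P" using P2[of "{1, 2, n - 1}"] W3 by linarith
  moreover have mark_P: "{2} \<notin> P" using P2[of "{2}"] by auto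
  moreover have W_ne: "{2} \<noteq> {1, 2, n - 1}" by auto
  ultimately have cF: "card F = n" using n finP by (simp add: F_def)
  have F_sub: "F \<subseteq> Pow {1..<n}" using n by (auto simp: F_def P_def)
  have rig: "split_rigid n F"
  proof (rule path_split_rigid[OF n'(2) F_sub, where a = 2])
    fix A assume "A \<in> F" "card A = 2"
    then have "A \<in> P" using W3 by (auto simp: F_def)
    then obtain i where "i \<in> {1..<n - 1}" "A = {i, i + 1}" unfolding P_def by blast
    then show "\<exists>i\<ge>1. i + 1 < n \<and> A = {i, i + 1}" by (intro exI[of _ i]) auto
  next
    fix A assume "A \<in> F"
    then have "A = {2} \<or> A = {1, 2, n - 1} \<or> A \<in> P" by (simp add: F_def)
    then have "card A \<le> 3" using P2[of A] W3 by auto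
    then show "card A \<noteq> n - 2" using n by simp
  next
    have "{n - 2} \<notin> P" using P2[of "{n - 2}"] by auto
    then show "{n - 2} \<notin> F" using n by (auto simp: F_def)
  qed (use n in \<open>auto simp: F_def P_def\<close>)
  have finF: "finite F" using finP by (simp add: F_def)
  obtain f where f: "bij_betw f {..<n} F"
    using ex_bij_betw_nat_finite[OF finF] cF by (auto simp: atLeast0LessThan)
  define v where "v i = {j. j < n \<and> i \<in> f j}" for i
  have inj: "inj_on v {..<n}" and rig_rows: "rigid n (v ` {..<n})"
    using rigid_rows_of_split_rigid[OF F_sub n'(1) rig f v_def] by auto
  have card_v: "card (v i) = card {A \<in> F. i \<in> A}" for i
  proof -
    have "f ` v i = {A \<in> F. i \<in> A}" using f by (auto simp: v_def bij_betw_def)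
    moreover have "inj_on f (v i)" using f by (auto simp: v_def bij_betw_def intro: inj_on_subset)
    ultimately show ?thesis using card_image by metis
  qed
  \<comment> \<open>the edges at row i, by their lower ends\<close>
  define K where "K i = {k \<in> {1..<n - 1}. k = i \<or> k + 1 = i}" for i
  have card_edges: "card {A \<in> P. i \<in> A} = card (K i)" for i
  proof -
    have "{A \<in> P. i \<in> A} = (\<lambda>k. {k, k + 1}) ` K i" unfolding P_def K_def by blast
    then show ?thesis by (simp only: card_image[OF inj_on_edge])
  qed
  have card_marks: "card {A \<in> {{2}, {1, 2, n - 1}}. i \<in> A} =
      (if i = 2 then 2 else if i = 1 \<or> i = n - 1 then 1 else 0)" for i
  proof -
    have "{A \<in> {{2}, {1, 2, n - 1}}. i \<in> A} =
        (if i = 2 then {{2}, {1, 2, n - 1}} else if i = 1 \<or> i = n - 1 then {{1, 2, n - 1}} else {})"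
      by auto
    then show ?thesis using W_ne by simp
  qed
  have card_star: "card (v i) = (if i = 2 then 2 else if i = 1 \<or> i = n - 1 then 1 else 0) + card (K i)" for i
  proof -
    have "{A \<in> F. i \<in> A} = {A \<in> {{2}, {1, 2, n - 1}}. i \<in> A} \<union> {A \<in> P. i \<in> A}"
      unfolding F_def by blast
    moreover have "{A \<in> {{2}, {1, 2, n - 1}}. i \<in> A} \<inter> {A \<in> P. i \<in> A} = {}"
      using W_P mark_P by blast
    ultimately show ?thesis
      unfolding card_v card_edges[symmetric] card_marks[symmetric]
      using finP by (simp add: card_Un_disjoint)
  qed
  have K: "K 0 = {}" "K 1 = {1}" "K (n - 1) = {n - 2}" using n by (auto simp: K_def)
  have K': "K i = {i - 1, i}" if "2 \<le> i" "i < n - 1" for i using that by (auto simp: K_def)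
  have ev: "even (card (v i))" if i: "i < n" for i
  proof -
    consider "i = 0" | "i = 1" | "i = n - 1" | "2 \<le> i" "i < n - 1" using i by linarith
    then show ?thesis using n by cases (auto simp: card_star K K' simp del: One_nat_def)
  qed
  have v2: "card (v 2) = 4" using n by (simp add: card_star K')
  have v0: "v 0 = {}" using card_star[of 0] K(1) n by (simp add: v_def)
  show ?thesis
  proof (rule has_asymmetric_even_frame[OF _ rig_rows _ _ _ _ _ k])
    show "v ` {..<n} \<subseteq> Pow {..<n}" by (auto simp: v_def)
    show "card (v ` {..<n}) = n" using card_image[OF inj] by simp
    show "{} \<in> v ` {..<n}" using v0 n by force
    show "v 2 \<in> v ` {..<n}" "2 < card (v 2)" using n v2 by auto
  qed (use ev in auto)
qed

section \<open>Rigid sets with distinct distance profiles\<close>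

text \<open>
  Automorphisms preserve distances, hence the sum of the squared distances from a vertex of \<open>S\<close>
  to all of \<open>S\<close>. If this sum tells the vertices of \<open>S\<close> apart, every automorphism that preserves
  \<open>S\<close> fixes each of them. Fixing \<open>{}\<close> excludes flips, and fixing a separating family of vertices
  excludes a permutation of the coordinates.
\<close>

lemma rigid_if_distinct_profiles:
  assumes S: "S \<subseteq> Pow {..<n}" and zero: "{} \<in> S"
    and sep: "\<And>j k. j < n \<Longrightarrow> k < n \<Longrightarrow> j \<noteq> k \<Longrightarrow> \<exists>v\<in>S. (j \<in> v) \<noteq> (k \<in> v)"
    and prof: "inj_on (\<lambda>v. \<Sum>w\<in>S. (card (sym_diff v w))\<^sup>2) S"
  shows "rigid n S"
  unfolding rigid_def
proof (intro allI impI, elim conjE)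
  fix \<pi> c assume p: "\<pi> permutes {..<n}" and c: "c \<subseteq> {..<n}" and img: "cube_map \<pi> c ` S = S"
  have inj: "inj_on (cube_map \<pi> c) S" using inj_cube_map[OF p] inj_on_subset by blast
  have dist: "card (sym_diff (cube_map \<pi> c v) (cube_map \<pi> c w)) = card (sym_diff v w)" for v w
  proof -
    have "sym_diff (cube_map \<pi> c v) (cube_map \<pi> c w) = sym_diff (\<pi> ` v) (\<pi> ` w)"
      unfolding cube_map_def by blast
    also have "\<dots> = \<pi> ` sym_diff v w"
      using permutes_inj[OF p] by (simp add: image_Un image_set_diff)
    finally show ?thesis using permutes_inj[OF p] by (simp add: card_image inj_on_subset)
  qed
  have fixed: "cube_map \<pi> c v = v" if v: "v \<in> S" for v
  proof -
    have "(\<Sum>w\<in>S. (card (sym_diff (cube_map \<pi> c v) w))\<^sup>2)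
        = (\<Sum>w\<in>cube_map \<pi> c ` S. (card (sym_diff (cube_map \<pi> c v) w))\<^sup>2)"
      by (simp only: img)
    also have "\<dots> = (\<Sum>w\<in>S. (card (sym_diff v w))\<^sup>2)"
      unfolding sum.reindex[OF inj] by (simp only: o_def dist)
    finally show ?thesis
      using prof v img by (auto simp: inj_on_def)
  qed
  have c0: "c = {}" using fixed[OF zero] by (simp add: cube_map_def)
  have "\<pi> j = j" if j: "j < n" for j
  proof (rule ccontr)
    assume "\<pi> j \<noteq> j"
    moreover have "\<pi> j < n" using permutes_in_image[OF p, of j] j by simp
    ultimately obtain v where v: "v \<in> S" "(\<pi> j \<in> v) \<noteq> (j \<in> v)" using sep j by blast
    show False using cube_map_mem[OF p, of j c v] fixed[OF v(1)] v(2) c0 by simp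
  qed
  then have "\<pi> j = j" for j using permutes_not_in[OF p, of j] by (cases "j < n") auto
  then show "\<pi> = id \<and> c = {}" using c0 by auto
qed

text \<open>
  The conditions of the preceding lemma for a concrete list, in a form that can be computed. The
  singletons other than the last separate all coordinates.
\<close>

definition profile_table :: "nat \<Rightarrow> nat set list \<Rightarrow> bool" where
  "profile_table n L \<longleftrightarrow>
    {} \<in> set L \<and> (\<forall>j\<in>set [0..<n - 1]. {j} \<in> set L) \<and> (\<forall>v\<in>set L. \<forall>j\<in>v. j < n) \<and>
    distinct (map (\<lambda>v. \<Sum>w\<leftarrow>L. (card (sym_diff v w))\<^sup>2) L)"

lemma has_asymmetric_table:
  assumes "profile_table n L"
  shows "has_asymmetric (length L) n"
proof -
  note t = assms[unfolded profile_table_def]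
  have dL: "distinct L" using t by (simp add: distinct_map)
  have "rigid n (set L)"
  proof (rule rigid_if_distinct_profiles)
    fix j k :: nat assume jk: "j < n" "k < n" "j \<noteq> k"
    \<comment> \<open>one of the two coordinates is not the last one\<close>
    then have "j \<in> set [0..<n - 1] \<or> k \<in> set [0..<n - 1]"
      unfolding set_upt atLeastLessThan_iff by linarith
    then have "{j} \<in> set L \<or> {k} \<in> set L" using t by blast
    then show "\<exists>v\<in>set L. (j \<in> v) \<noteq> (k \<in> v)"
    proof
      assume "{j} \<in> set L"
      then show ?thesis using jk(3) by (intro bexI[of _ "{j}"]) simp_all
    next
      assume "{k} \<in> set L"
      then show ?thesis using jk(3) by (intro bexI[of _ "{k}"]) simp_all
    qed
  next
    show "inj_on (\<lambda>v. \<Sum>w\<in>set L. (card (sym_diff v w))\<^sup>2) (set L)"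
      using t dL by (simp add: distinct_map sum_list_distinct_conv_sum_set)
  qed (use t in auto)
  moreover have "card (set L) = length L" using dL by (rule distinct_card)
  moreover have "set L \<subseteq> Pow {..<n}" using t by auto
  ultimately show ?thesis unfolding has_asymmetric_iff_rigid by blast
qed

lemma has_asymmetric_dim4:
  assumes "6 \<le> m" "m \<le> 8"
  shows "has_asymmetric m 4"
proof -
  have "profile_table 4 [{}, {0}, {1}, {0, 1}, {2}, {0, 2, 3}]"
    "profile_table 4 [{}, {0}, {1}, {0, 1}, {2}, {0, 3}, {1, 2, 3}]"
    "profile_table 4 [{}, {0}, {1}, {0, 1}, {2}, {0, 2}, {3}, {0, 1, 3}]"
    by code_simp+
  then have "has_asymmetric 6 4" "has_asymmetric 7 4" "has_asymmetric 8 4"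
    by (auto simp: numeral_eq_Suc dest!: has_asymmetric_table)
  moreover have "m = 6 \<or> m = 7 \<or> m = 8" using assms by linarith
  ultimately show ?thesis by blast
qed

text \<open>
  One list serves all sizes, through its initial segments.
\<close>

lemma has_asymmetric_dim5:
  assumes "7 \<le> m" "m \<le> 16"
  shows "has_asymmetric m 5"
proof -
  let ?L = "[{}, {0}, {1}, {2}, {3}, {0, 2, 4}, {2, 3}, {1, 3}, {1, 2, 4}, {1, 2}, {2, 4}, {4},
    {0, 3}, {1, 2, 3}, {0, 3, 4}, {3, 4::nat}]"
  have "\<forall>m\<in>set [7..<17]. profile_table 5 (take m ?L)"
    by code_simp
  moreover have "m \<in> set [7..<17]" unfolding set_upt using assms by simp
  ultimately have "has_asymmetric (length (take m ?L)) 5" by (blast intro: has_asymmetric_table)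
  moreover have "length (take m ?L) = m" using assms by simp
  ultimately show ?thesis by (simp only:)
qed

section \<open>The attained sizes\<close>

text \<open>
  Up to \<open>n + 1\<close> rows the path construction applies, and beyond that the frame of \<open>n\<close> even
  vertices is used. In dimensions 4 and 5 there is no such frame, and tables take its place.
\<close>

lemma has_asymmetric_half:
  assumes m: "5 \<le> m" "m \<le> 2 ^ (n - 1)" and n: "4 \<le> n" "n \<le> 2 ^ (m - 2)"
  shows "has_asymmetric m n"
proof (cases "m \<le> n + 1")
  case True
  then show ?thesis using has_asymmetric_path m(1) n(2) by simp
next
  case False
  consider "n = 4" | "n = 5" | "6 \<le> n" using n(1) by linarith
  then show ?thesis
  proof cases
    case 1
    then show ?thesis using has_asymmetric_dim4[of m] False m by simp
  next
    case 2
    then show ?thesis using has_asymmetric_dim5[of m] False m by simp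
  next
    case 3
    then show ?thesis using has_asymmetric_large[of n "m - n"] False m(2) by simp
  qed
qed

lemma le_power_double_exp:
  assumes "4 \<le> n"
  shows "n \<le> 2 ^ (2 ^ (n - 2) - 2)"
proof -
  have *: "k + 2 \<le> 2 ^ k" if "2 \<le> k" for k :: nat
    using that by (induction k rule: dec_induct) auto
  have "n - 2 + 2 \<le> 2 ^ (n - 2)" using assms by (intro *) simp
  then have "n \<le> 2 ^ (n - 2)" using assms by simp
  moreover have "n - 2 \<le> 2 ^ (n - 2) - 2" using \<open>n \<le> 2 ^ (n - 2)\<close> by linarith
  then have "(2::nat) ^ (n - 2) \<le> 2 ^ (2 ^ (n - 2) - 2)" by (intro power_increasing) auto
  ultimately show ?thesis by linarith
qed

lemma le_power_minus_two:
  assumes n: "4 \<le> n" and m: "2 ^ (n - 2) \<le> m"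
  shows "n \<le> 2 ^ (m - 2)"
proof -
  have "(2::nat) ^ (2 ^ (n - 2) - 2) \<le> 2 ^ (m - 2)" using m by (intro power_increasing) auto
  then show ?thesis using le_power_double_exp[OF n] by linarith
qed

lemma mu_properties:
  assumes n: "4 \<le> n"
  shows "has_asymmetric (\<mu> n) n" and "5 \<le> \<mu> n" and "\<mu> n \<le> 2 ^ (n - 1)"
    and "has_asymmetric m n \<Longrightarrow> \<mu> n \<le> m"
proof -
  have mu: "\<mu> n = (LEAST m. has_asymmetric m n)" by (simp add: \<mu>_def has_asymmetric_def)
  have "8 = (2::nat) ^ (4 - 1)" by simp
  also have "(2::nat) ^ (4 - 1) \<le> 2 ^ (n - 1)" using n by (intro power_increasing) auto
  finally have eight: "8 \<le> (2::nat) ^ (n - 1)" .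
  have "(2::nat) ^ (n - 2) \<le> 2 ^ (n - 1)" by (intro power_increasing) auto
  then have half: "has_asymmetric (2 ^ (n - 1)) n"
    using n eight le_power_minus_two[OF n] by (intro has_asymmetric_half) auto
  show "has_asymmetric (\<mu> n) n" unfolding mu using half by (rule LeastI)
  then show "5 \<le> \<mu> n" using has_asymmetric_rows_ge n by simp
  show "\<mu> n \<le> 2 ^ (n - 1)" unfolding mu using half by (rule Least_le)
  show "has_asymmetric m n \<Longrightarrow> \<mu> n \<le> m" unfolding mu by (rule Least_le)
qed

text \<open>
  If \<open>m\<close> exceeds \<open>\<mu> n\<close>, then \<open>n \<le> 2 ^ (\<mu> n - 1) \<le> 2 ^ (m - 2)\<close>, which is the bound on the number
  of columns that the constructions require. This settles \<open>m \<le> 2 ^ (n - 1)\<close>, and complements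
  settle the rest.
\<close>

lemma has_asymmetric_iff_between:
  assumes n: "4 \<le> n"
  shows "has_asymmetric m n \<longleftrightarrow> \<mu> n \<le> m \<and> m + \<mu> n \<le> 2 ^ n"
proof
  assume att: "has_asymmetric m n"
  then show "\<mu> n \<le> m \<and> m + \<mu> n \<le> 2 ^ n"
    using mu_properties(4)[OF n, of m] mu_properties(4)[OF n, of "2 ^ n - m"] has_asymmetric_complement[OF att]
    by linarith
next
  have lower: "has_asymmetric k n" if k: "\<mu> n \<le> k" "k \<le> 2 ^ (n - 1)" for k
  proof (cases "k = \<mu> n")
    case True
    then show ?thesis using mu_properties(1)[OF n] by simp
  next
    case False
    have "n \<le> 2 ^ (\<mu> n - 1)"
      using has_asymmetric_columns_le[OF mu_properties(1)[OF n]] mu_properties(2)[OF n] by simp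
    also have "(2::nat) ^ (\<mu> n - 1) \<le> 2 ^ (k - 2)" using False k(1) by (intro power_increasing) auto
    finally show ?thesis using has_asymmetric_half[of k n] k n mu_properties(2)[OF n] by simp
  qed
  assume m: "\<mu> n \<le> m \<and> m + \<mu> n \<le> 2 ^ n"
  have two: "(2::nat) ^ n = 2 * 2 ^ (n - 1)" using n by (cases n) auto
  show "has_asymmetric m n"
  proof (cases "m \<le> 2 ^ (n - 1)")
    case True
    then show ?thesis using lower m by simp
  next
    case False
    then have "has_asymmetric (2 ^ n - m) n" using m two by (intro lower) linarith+
    then have "has_asymmetric (2 ^ n - (2 ^ n - m)) n" by (rule has_asymmetric_complement(2))
    then show ?thesis using m by simp
  qed
qed

lemma mu_4: "\<mu> 4 = 5"
  using mu_properties(2)[of 4] mu_properties(4)[of 4 5] has_asymmetric_path[of 5 4] by simp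

text \<open>
  With three columns and at least five rows, the complementary set of vertices has at most three
  elements.
\<close>

lemma no_asymmetric_few_columns:
  assumes m: "5 \<le> m" and n: "n \<le> 3"
  shows "\<not> has_asymmetric m n"
proof
  assume att: "has_asymmetric m n"
  have "m \<le> 2 ^ n" by (rule has_asymmetric_complement(1)[OF att])
  also have le8: "(2::nat) ^ n \<le> 2 ^ 3" using n by (intro power_increasing) auto
  finally have m8: "m \<le> 8" by simp
  have "2 \<le> n"
  proof (rule ccontr)
    assume "\<not> 2 \<le> n"
    then have "(2::nat) ^ n \<le> 2 ^ 1" by (intro power_increasing) auto
    then show False using \<open>m \<le> 2 ^ n\<close> m by simp
  qed
  then have "5 \<le> 2 ^ n - m" by (intro has_asymmetric_rows_ge[OF has_asymmetric_complement(2)[OF att]])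
  then show False using le8 m by simp
qed

lemma nu_eqI:
  assumes "has_asymmetric m n" and "\<And>k. k < n \<Longrightarrow> \<not> has_asymmetric m k"
  shows "\<nu> m = n"
  unfolding \<nu>_def has_asymmetric_def[symmetric]
  using assms by (intro Least_equality) (auto simp: not_less[symmetric])

definition max_rows :: "nat \<Rightarrow> nat" where
  "max_rows n = 2 ^ n - \<mu> n"

lemma max_rows_bounds:
  assumes n: "4 \<le> n"
  shows "2 ^ (n - 1) \<le> max_rows n" "max_rows n < 2 ^ n" "max_rows n + \<mu> n = 2 ^ n"
proof -
  have two: "(2::nat) ^ n = 2 * 2 ^ (n - 1)" using n by (cases n) auto
  show "2 ^ (n - 1) \<le> max_rows n" "max_rows n < 2 ^ n" "max_rows n + \<mu> n = 2 ^ n"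
    using mu_properties(2,3)[OF n] two by (simp_all add: max_rows_def)
qed

text \<open>
  Between two consecutive values of \<open>max_rows\<close> lies a power of two, because
  \<open>0 < \<mu> n \<le> 2 ^ (n - 1)\<close>.
\<close>

lemma max_rows_strict_mono:
  assumes "4 \<le> k" "k < n"
  shows "max_rows k < max_rows n"
proof -
  have "max_rows k < 2 ^ k" using assms by (intro max_rows_bounds(2))
  also have "(2::nat) ^ k \<le> 2 ^ (n - 1)" using assms by (intro power_increasing) auto
  also have "\<dots> \<le> max_rows n" using assms by (intro max_rows_bounds(1)) auto
  finally show ?thesis .
qed

text \<open>
  A matrix with fewer columns, but at least four, admits fewer than \<open>m\<close> rows because \<open>max_rows\<close>
  grows with the number of columns.
\<close>

lemma nu_eq:
  assumes n: "5 \<le> n" and m: "max_rows (n - 1) < m" "m \<le> max_rows n"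
  shows "\<nu> m = n"
proof (rule nu_eqI)
  have n4: "4 \<le> n" "4 \<le> n - 1" using n by auto
  have "2 ^ (n - 2) \<le> max_rows (n - 1)"
    using max_rows_bounds(1)[OF n4(2)] by (simp add: diff_diff_left flip: numeral_2_eq_2)
  then have ge: "2 ^ (n - 2) \<le> m" using m(1) by linarith
  have "(2::nat) ^ 3 \<le> 2 ^ (n - 2)" using n by (intro power_increasing) auto
  then have m5: "5 \<le> m" using ge by simp
  show "has_asymmetric m n"
  proof (cases "m \<le> 2 ^ (n - 1)")
    case True
    then show ?thesis using has_asymmetric_half[OF m5 _ n4(1)] le_power_minus_two[OF n4(1) ge] by simp
  next
    case False
    then show ?thesis
      using has_asymmetric_iff_between[OF n4(1)] mu_properties(3)[OF n4(1)] max_rows_bounds(3)[OF n4(1)] m(2)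
      by simp
  qed
  fix k assume k: "k < n"
  show "\<not> has_asymmetric m k"
  proof (cases "k \<le> 3")
    case True
    then show ?thesis using no_asymmetric_few_columns[OF m5] by simp
  next
    case False
    have "k = n - 1 \<or> k < n - 1" using k by linarith
    then have "max_rows k \<le> max_rows (n - 1)"
      using max_rows_strict_mono[of k "n - 1"] False by fastforce
    then show ?thesis
      using has_asymmetric_iff_between[of k m] max_rows_bounds(3)[of k] False m(1) by simp
  qed
qed

theorem theorem12:
  shows "(\<forall>m::nat. 5 \<le> m \<and> m \<le> 11 \<longrightarrow> \<nu> m = 4) \<and>
    (\<forall>m::nat. 12 \<le> m \<longrightarrow>
      (\<exists>!n::nat. 5 \<le> n \<and> 2 ^ (n - 1) - int (\<mu> (n - 1)) + 1 \<le> int m \<and> int m \<le> 2 ^ n - int (\<mu> n)) \<and>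
      (\<forall>n::nat. 5 \<le> n \<and> 2 ^ (n - 1) - int (\<mu> (n - 1)) + 1 \<le> int m \<and> int m \<le> 2 ^ n - int (\<mu> n)
        \<longrightarrow> \<nu> m = n))"
proof -
  have int_eq: "2 ^ n - int (\<mu> n) = int (max_rows n)" if "4 \<le> n" for n
    using arg_cong[OF max_rows_bounds(3)[OF that], of int] by simp
  have range: "5 \<le> n \<and> 2 ^ (n - 1) - int (\<mu> (n - 1)) + 1 \<le> int m \<and> int m \<le> 2 ^ n - int (\<mu> n)
      \<longleftrightarrow> 5 \<le> n \<and> max_rows (n - 1) < m \<and> m \<le> max_rows n" for n m
    using int_eq[of n] int_eq[of "n - 1"] by auto
  have small: "\<nu> m = 4" if m: "5 \<le> m" "m \<le> 11" for m
  proof (rule nu_eqI)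
    show "has_asymmetric m 4" using m by (simp add: has_asymmetric_iff_between mu_4)
  qed (use no_asymmetric_few_columns[OF m(1)] in simp)
  have "\<exists>!n. 5 \<le> n \<and> max_rows (n - 1) < m \<and> m \<le> max_rows n" if m: "12 \<le> m" for m
  proof -
    have "m < 2 ^ (m + 4)" using less_exp[of "m + 4"] by linarith
    also have "(2::nat) ^ (m + 4) \<le> max_rows (m + 5)" using max_rows_bounds(1)[of "m + 5"] by (simp add: add.commute)
    finally have ex: "5 \<le> m + 5 \<and> m \<le> max_rows (m + 5)" by simp
    define n where "n = (LEAST n. 5 \<le> n \<and> m \<le> max_rows n)"
    have n: "5 \<le> n" "m \<le> max_rows n"
      unfolding n_def using LeastI[of "\<lambda>n. 5 \<le> n \<and> m \<le> max_rows n", OF ex] by auto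
    have "max_rows (n - 1) < m"
    proof (cases "n = 5")
      case True
      then show ?thesis using m by (simp add: max_rows_def mu_4)
    next
      case False
      then have "\<not> (5 \<le> n - 1 \<and> m \<le> max_rows (n - 1))"
        using not_less_Least[of "n - 1" "\<lambda>n. 5 \<le> n \<and> m \<le> max_rows n"] n(1) by (simp add: n_def)
      then show ?thesis using n(1) False by linarith
    qed
    moreover have "k = n" if k: "5 \<le> k" "max_rows (k - 1) < m" "m \<le> max_rows k" for k
    proof -
      have "a \<le> b" if ab: "5 \<le> a" "max_rows (a - 1) < m" "5 \<le> b" "m \<le> max_rows b" for a b
      proof (rule ccontr)
        assume "\<not> a \<le> b"
        then have "b = a - 1 \<or> b < a - 1" by linarith
        then have "max_rows b \<le> max_rows (a - 1)"
          using max_rows_strict_mono[of b "a - 1"] ab(3) by fastforce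
        then show False using ab by linarith
      qed
      then show ?thesis using k n \<open>max_rows (n - 1) < m\<close> by (meson le_antisym)
    qed
    ultimately show ?thesis using n by blast
  qed
  then show ?thesis unfolding range using small nu_eq by blast
qed

end
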